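(* For $\mathcal L_2$-a.e. $\lambda\in\mathbb C$ with $$|\lambda|\in\bigcup_{k=2}^\infty\big(2^{-1/(2k)},\,(2\cdot5^{-5/8})^{1/k}\big),$$ the measure $\nu_\lambda$ is absolutely continuous with a continuous density; hence $A_\lambda$ has non-empty interior. In particular this holds for $\mathcal L_2$-a.e. $\lambda\in\mathbb D$ with $|\lambda|>2^{-1/20}$.
   Context: $\mathbb D$ is the open unit disc, $\mathcal L_2$ area measure. $\nu_\lambda$ is the distribution of the random series $\sum_{n\ge0}\pm\lambda^n$ with independent fair signs; $A_\lambda=\{\sum_{n\ge0}a_n\lambda^n:a_n\in\{-1,1\}\}$ is its support. *)

theory Defs
  imports "HOL-Probability.Probability"
begin

definition sign_space :: "(nat \<Rightarrow> real) measure" where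
  "sign_space = PiM UNIV (\<lambda>_. measure_pmf (pmf_of_set {-1, 1::real}))"

definition signed_series :: "complex \<Rightarrow> (nat \<Rightarrow> real) \<Rightarrow> complex" where
  "signed_series l a = (\<Sum>n. complex_of_real (a n) * l ^ n)"

definition nu :: "complex \<Rightarrow> complex measure" where
  "nu l = distr sign_space borel (signed_series l)"

definition A_set :: "complex \<Rightarrow> complex set" where
  "A_set l = {signed_series l a | a. \<forall>n. a n \<in> {-1, 1}}"

definition good_param :: "complex \<Rightarrow> bool" where
  "good_param l \<longleftrightarrow>
     absolutely_continuous lborel (nu l) \<and>
     (\<exists>f :: complex \<Rightarrow> real. continuous_on UNIV f \<and> (\<forall>z. 0 \<le> f z) \<and>
        nu l = density lborel (\<lambda>z. ennreal (f z))) \<and>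
     interior (A_set l) \<noteq> {}"

end

theory Submission
  imports Defs
begin

text \<open>
  The Fourier transform of \<open>nu l\<close> is the product of the factors \<open>cos (\<xi> \<bullet> l ^ n)\<close>. Keeping only the
  factors with \<open>n \<equiv> 0\<close> and \<open>n \<equiv> 1\<close> modulo \<open>k\<close> bounds it by a product of two functions, each of
  which is, up to a rotation and dilation of \<open>\<xi>\<close>, the Fourier transform of \<open>nu (l ^ k)\<close>. If both
  are square integrable, the Fourier transform of \<open>nu l\<close> is integrable and \<open>nu l\<close> has a continuous density.

  Square integrability for almost every \<open>l\<close> follows by integrating over a small disc of parameters:
  expanding the squared cosines reduces this to Gaussian averages of \<open>2 * l ^ (k * n) * f (l ^ k)\<close>,
  where \<open>f\<close> is a polynomial with \<open>f 0 = 1\<close> and real coefficients in \<open>[-1, 1]\<close>. Such an \<open>f\<close> is transversal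
  (\<open>f\<close> and its derivative are not both small at a point) at non-real points of modulus less than
  \<open>2 * 5 powr (-5/8)\<close>: near a double zero there is a conjugate one, and Jensen's
  inequality allows no four zeros so close to the origin. The averages are then
  \<open>O (\<bar>l ^ k\<bar> powr (- 2 * n))\<close>, which is summable against the weights \<open>2 powr (- n)\<close> as \<open>\<bar>l ^ k\<bar>\<^sup>2 > 1/2\<close>.
\<close>

section \<open>Gaussian integrals\<close>

text \<open>After rescaling \<open>t\<close> by \<open>sqrt s\<close> this is the characteristic
  function of the standard normal distribution at \<open>x / sqrt s\<close>.\<close>

lemma gaussian_fourier_real:
  fixes s x :: real
  assumes "s > 0"
  shows "has_bochner_integral lborel (\<lambda>t. iexp (t * x) * complex_of_real (exp (- s * t\<^sup>2 / 2)))
           (complex_of_real (sqrt (2 * pi / s) * exp (- x\<^sup>2 / (2 * s))))"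
proof -
  define u where "u = x / sqrt s"
  have int: "integrable lborel (\<lambda>t. std_normal_density t *\<^sub>R iexp (u * t))"
    by (rule Bochner_Integration.integrable_bound[OF integrable_normal_density[of 1 0]]) auto
  have "(\<integral>t. std_normal_density t *\<^sub>R iexp (u * t) \<partial>lborel) = char std_normal_distribution u"
    unfolding char_def by (subst integral_density) auto
  also have "\<dots> = complex_of_real (exp (- u\<^sup>2 / 2))"
    by (simp add: char_std_normal_distribution)
  finally have "has_bochner_integral lborel (\<lambda>t. std_normal_density t *\<^sub>R iexp (u * t)) (complex_of_real (exp (- u\<^sup>2 / 2)))"
    using int by (simp add: has_bochner_integral_iff)
  then have "has_bochner_integral lborel (\<lambda>t. complex_of_real (sqrt (2 * pi)) * (std_normal_density t *\<^sub>R iexp (u * t)))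
      (complex_of_real (sqrt (2 * pi)) * complex_of_real (exp (- u\<^sup>2 / 2)))"
    by (rule has_bochner_integral_mult_right)
  also have "(\<lambda>t. complex_of_real (sqrt (2 * pi)) * (std_normal_density t *\<^sub>R iexp (u * t)))
      = (\<lambda>t. iexp (u * t) * complex_of_real (exp (- t\<^sup>2 / 2)))"
    by (auto simp: std_normal_density_def scaleR_conv_of_real)
  finally have "has_bochner_integral lborel (\<lambda>t. iexp (u * (0 + sqrt s * t)) * complex_of_real (exp (- (0 + sqrt s * t)\<^sup>2 / 2)))
      ((complex_of_real (sqrt (2 * pi)) * complex_of_real (exp (- u\<^sup>2 / 2))) /\<^sub>R \<bar>sqrt s\<bar>)"
    by (subst (asm) lborel_has_bochner_integral_real_affine_iff[where t=0 and c="sqrt s"])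
       (use assms in auto)
  also have "(\<lambda>t. iexp (u * (0 + sqrt s * t)) * complex_of_real (exp (- (0 + sqrt s * t)\<^sup>2 / 2)))
     = (\<lambda>t. iexp (t * x) * complex_of_real (exp (- s * t\<^sup>2 / 2)))"
    using assms by (auto simp: u_def power_mult_distrib mult.commute)
  also have "(complex_of_real (sqrt (2 * pi)) * complex_of_real (exp (- u\<^sup>2 / 2))) /\<^sub>R \<bar>sqrt s\<bar>
     = complex_of_real (sqrt (2 * pi / s) * exp (- x\<^sup>2 / (2 * s)))"
    using assms by (simp add: u_def power_divide scaleR_conv_of_real real_sqrt_divide field_simps)
  finally show ?thesis .
qed

text \<open>In coordinates, \<open>iexp (\<xi> \<bullet> x)\<close> times the Gaussian is a product
  of one-dimensional integrands, so the integral over the product measure factors. The cosine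
  version is its real part.\<close>

lemma gaussian_fourier:
  fixes x :: "'a::euclidean_space"
  assumes "s > 0"
  shows "has_bochner_integral lborel (\<lambda>\<xi>::'a. cos (\<xi> \<bullet> x) * exp (- s * (norm \<xi>)\<^sup>2 / 2))
           (sqrt (2 * pi / s) ^ DIM('a) * exp (- (norm x)\<^sup>2 / (2 * s)))"
proof -
  interpret product_sigma_finite "\<lambda>_::'a. lborel :: real measure" ..
  define g where "g b t = iexp (t * (x \<bullet> b)) * complex_of_real (exp (- s * t\<^sup>2 / 2))" for b t
  define F where "F \<xi> = (\<Prod>b\<in>Basis. g b (\<xi> \<bullet> b))" for \<xi> :: 'a
  have [measurable]: "g b \<in> borel_measurable borel" for b
    unfolding g_def by measurable
  have [measurable]: "F \<in> borel_measurable borel" unfolding F_def by measurable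
  have gb: "integrable lborel (g b)"
    "integral\<^sup>L lborel (g b) = complex_of_real (sqrt (2 * pi / s) * exp (- (x \<bullet> b)\<^sup>2 / (2 * s)))" for b
    using gaussian_fourier_real[OF assms, of "x \<bullet> b"]
    unfolding g_def by (simp_all only: has_bochner_integral_iff)
  have F: "F \<xi> = iexp (\<xi> \<bullet> x) * complex_of_real (exp (- s * (norm \<xi>)\<^sup>2 / 2))" for \<xi>
  proof -
    have "F \<xi> = exp (\<Sum>b\<in>Basis. \<i> * complex_of_real ((\<xi> \<bullet> b) * (x \<bullet> b)) + complex_of_real (- s * (\<xi> \<bullet> b)\<^sup>2 / 2))"
      unfolding F_def g_def exp_sum[OF finite_Basis] exp_add exp_of_real ..
    also have "(\<Sum>b\<in>Basis. \<i> * complex_of_real ((\<xi> \<bullet> b) * (x \<bullet> b)) + complex_of_real (- s * (\<xi> \<bullet> b)\<^sup>2 / 2))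
       = \<i> * complex_of_real (\<Sum>b\<in>Basis. (\<xi> \<bullet> b) * (x \<bullet> b)) + complex_of_real (- s * (\<Sum>b\<in>Basis. (\<xi> \<bullet> b)\<^sup>2) / 2)"
      by (simp add: sum.distrib sum_subtractf sum_distrib_left sum_negf sum_divide_distrib)
    also have "(\<Sum>b\<in>Basis. (\<xi> \<bullet> b) * (x \<bullet> b)) = \<xi> \<bullet> x" by (rule euclidean_inner[symmetric])
    also have "(\<Sum>b\<in>Basis. (\<xi> \<bullet> b)\<^sup>2) = (norm \<xi>)\<^sup>2"
      unfolding power2_norm_eq_inner by (subst (2) euclidean_inner) (simp add: power2_eq_square)
    finally show ?thesis unfolding exp_add exp_of_real .
  qed
  have T: "(\<lambda>f. \<Sum>b\<in>Basis. f b *\<^sub>R b) \<in> (\<Pi>\<^sub>M b\<in>Basis. lborel) \<rightarrow>\<^sub>M (borel :: 'a measure)"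
    by measurable
  have FT: "F (\<Sum>b\<in>Basis. f b *\<^sub>R b) = (\<Prod>b\<in>Basis. g b (f b))" for f
    unfolding F_def by (intro prod.cong) auto
  have "integrable (\<Pi>\<^sub>M b\<in>Basis. lborel) (\<lambda>f. F (\<Sum>b\<in>Basis. f b *\<^sub>R b))"
    unfolding FT by (rule product_integrable_prod) (auto simp: gb)
  then have int: "integrable lborel F"
    by (subst lborel_eq) (subst integrable_distr_eq[OF T], auto)
  have "integral\<^sup>L lborel F = (\<integral>f. F (\<Sum>b\<in>Basis. f b *\<^sub>R b) \<partial>(\<Pi>\<^sub>M b\<in>Basis. lborel))"
    by (subst lborel_eq) (subst integral_distr[OF T], auto)
  also have "\<dots> = (\<Prod>b\<in>Basis. integral\<^sup>L lborel (g b))"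
    unfolding FT by (rule product_integral_prod) (auto simp: gb)
  also have "\<dots> = complex_of_real (\<Prod>b\<in>(Basis::'a set). sqrt (2 * pi / s) * exp (- (x \<bullet> b)\<^sup>2 / (2 * s)))"
    unfolding gb by simp
  also have "(\<Prod>b\<in>(Basis::'a set). sqrt (2 * pi / s) * exp (- (x \<bullet> b)\<^sup>2 / (2 * s)))
     = sqrt (2 * pi / s) ^ DIM('a) * exp (\<Sum>b\<in>Basis. - (x \<bullet> b)\<^sup>2 / (2 * s))"
    by (simp add: prod.distrib exp_sum)
  also have "(\<Sum>b\<in>Basis. - (x \<bullet> b)\<^sup>2 / (2 * s)) = - (norm x)\<^sup>2 / (2 * s)"
    unfolding power2_norm_eq_inner
    by (subst (2) euclidean_inner) (simp add: power2_eq_square sum_negf sum_divide_distrib)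
  finally have "has_bochner_integral lborel F (complex_of_real (sqrt (2 * pi / s) ^ DIM('a) * exp (- (norm x)\<^sup>2 / (2 * s))))"
    using int by (simp add: has_bochner_integral_iff)
  then have "has_bochner_integral lborel (\<lambda>\<xi>. Re (F \<xi>)) (Re (complex_of_real (sqrt (2 * pi / s) ^ DIM('a) * exp (- (norm x)\<^sup>2 / (2 * s)))))"
    by (rule has_bochner_integral_Re)
  then show ?thesis by (simp add: F Re_exp mult.commute)
qed

lemma gaussian_integrable:
  assumes "s > 0"
  shows "integrable lborel (\<lambda>\<xi>::'a::euclidean_space. exp (- s * (norm \<xi>)\<^sup>2 / 2))"
    and "(\<integral>\<xi>. exp (- s * (norm (\<xi>::'a))\<^sup>2 / 2) \<partial>lborel) = sqrt (2 * pi / s) ^ DIM('a)"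
  using gaussian_fourier[OF assms, of "0::'a"] by (simp_all add: has_bochner_integral_iff)

section \<open>Densities from integrable Fourier transforms\<close>

text \<open>Smooth \<open>N\<close> by a centred Gaussian of variance \<open>s n\<close> tending to
  0. The smoothed measures have densities \<open>F n\<close> converging pointwise to the inversion
  integral \<open>f\<close>, with \<open>g\<close> as dominating function. Fatou and outer
  regularity give \<open>N \<le> D\<close> for the measure \<open>D\<close> with density
  \<open>f\<close>; as \<open>D\<close> has mass at most 1, equality follows. Putting
  \<open>z\<close> inside the cosine keeps everything real: the omitted sine part is odd in \<xi>
  and would integrate to 0.\<close>

lemma fourier_inversion_density:
  fixes N :: "'a::euclidean_space measure"
  assumes prob: "prob_space N" and sets_N: "sets N = sets borel" and g: "integrable lborel g"
    and le: "\<And>\<xi> z. \<bar>\<integral>x. cos (\<xi> \<bullet> (z - x)) \<partial>N\<bar> \<le> g \<xi>"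
  shows "\<exists>f. continuous_on UNIV f \<and> (\<forall>z. 0 \<le> f z) \<and> N = density lborel (\<lambda>z. ennreal (f z))"
proof -
  interpret prob_space N by fact
  interpret pair_sigma_finite N "lborel :: 'a measure" ..
  note [measurable_cong] = sets_N
  have space_N: "space N = UNIV" using sets_eq_imp_space_eq[OF sets_N] by simp
  define \<psi> where "\<psi> \<xi> z = (\<integral>x. cos (\<xi> \<bullet> (z - x)) \<partial>N)" for \<xi> z
  have [measurable]: "(\<lambda>\<xi>. \<psi> \<xi> z) \<in> borel_measurable borel" for z
    unfolding \<psi>_def by measurable
  have \<psi>_le: "\<bar>\<psi> \<xi> z\<bar> \<le> g \<xi>" for \<xi> z using le by (simp add: \<psi>_def)
  have gm[measurable]: "g \<in> borel_measurable borel"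
    using borel_measurable_integrable[OF g] by simp
  define d where "d = DIM('a)"
  \<comment> \<open>The constant of Fourier inversion; with it \<open>G n\<close> is the density of
    the centred normal law with covariance \<open>s n\<close> times the identity.\<close>
  define c where "c = 1 / (2 * pi) ^ d"
  have c: "c > 0" by (simp add: c_def)
  define s where "s n = 1 / (real n + 1)" for n
  have s: "s n > 0" for n by (simp add: s_def)
  have s0: "s \<longlonglongrightarrow> 0" unfolding s_def using LIMSEQ_inverse_real_of_nat by (simp add: inverse_eq_divide add.commute)
  define f where "f z = c * (\<integral>\<xi>. \<psi> \<xi> z \<partial>lborel)" for z
  define F where "F n z = c * (\<integral>\<xi>. \<psi> \<xi> z * exp (- s n * (norm \<xi>)\<^sup>2 / 2) \<partial>lborel)" for n z
  define G where "G n w = c * (sqrt (2 * pi / s n) ^ d * exp (- (norm (w::'a))\<^sup>2 / (2 * s n)))" for n w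
  have Gn: "G n w \<ge> 0" for n w using c s[of n] by (simp add: G_def)
  have [measurable]: "G n \<in> borel_measurable borel" for n unfolding G_def by measurable
  have G_le: "G n w \<le> c * sqrt (2 * pi / s n) ^ d" for n w
    using c s[of n] by (simp add: G_def mult_left_le)
  have intG: "integrable N (\<lambda>x. G n (z - x))" for n z
    by (rule integrable_const_bound[where B="c * sqrt (2 * pi / s n) ^ d"]) (auto simp: Gn G_le)
  \<comment> \<open>By Fubini, \<open>F n\<close> is the density of \<open>N\<close> convolved with
    that normal law, hence nonnegative, which the oscillatory definition does not show.\<close>
  have F_eq: "F n z = (\<integral>x. G n (z - x) \<partial>N)" for n z
  proof -
    have 1: "integrable (N \<Otimes>\<^sub>M lborel) (\<lambda>(x, \<xi>). exp (- s n * (norm (\<xi>::'a))\<^sup>2 / 2))"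
      by (rule Fubini_integrable) (use gaussian_integrable(1)[OF s[of n], where 'a='a] in \<open>auto intro!: AE_I2\<close>)
    have 2: "integrable (N \<Otimes>\<^sub>M lborel) (\<lambda>(x, \<xi>). cos (\<xi> \<bullet> (z - x)) * exp (- s n * (norm \<xi>)\<^sup>2 / 2))"
      by (rule Bochner_Integration.integrable_bound[OF 1]) (auto simp: abs_mult intro!: AE_I2)
    have "(\<integral>\<xi>. \<psi> \<xi> z * exp (- s n * (norm \<xi>)\<^sup>2 / 2) \<partial>lborel)
        = (\<integral>\<xi>. (\<integral>x. cos (\<xi> \<bullet> (z - x)) * exp (- s n * (norm \<xi>)\<^sup>2 / 2) \<partial>N) \<partial>lborel)"
      by (simp add: \<psi>_def)
    also have "\<dots> = (\<integral>x. (\<integral>\<xi>. cos (\<xi> \<bullet> (z - x)) * exp (- s n * (norm \<xi>)\<^sup>2 / 2) \<partial>lborel) \<partial>N)"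
      by (rule Fubini_integral[OF 2])
    also have "\<dots> = (\<integral>x. sqrt (2 * pi / s n) ^ d * exp (- (norm (z - x))\<^sup>2 / (2 * s n)) \<partial>N)"
      using gaussian_fourier[OF s] unfolding has_bochner_integral_iff d_def
      by (intro Bochner_Integration.integral_cong refl) blast
    finally show ?thesis unfolding F_def G_def by simp
  qed
  have Fm[measurable]: "F n \<in> borel_measurable borel" for n
    unfolding F_eq by measurable
  have Fn: "F n z \<ge> 0" for n z unfolding F_eq by (intro integral_nonneg_AE) (simp add: Gn)
  have F_lim: "(\<lambda>n. F n z) \<longlonglongrightarrow> f z" for z
    unfolding F_def f_def
  proof (intro tendsto_mult tendsto_const, rule integral_dominated_convergence[where w=g])
    have "(\<lambda>n. \<psi> \<xi> z * exp (- s n * (norm \<xi>)\<^sup>2 / 2)) \<longlonglongrightarrow> \<psi> \<xi> z * exp (- 0 * (norm \<xi>)\<^sup>2 / 2)" for \<xi>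
      by (intro tendsto_intros s0) auto
    then show "AE \<xi> in lborel. (\<lambda>n. \<psi> \<xi> z * exp (- s n * (norm \<xi>)\<^sup>2 / 2)) \<longlonglongrightarrow> \<psi> \<xi> z"
      by simp
    show "AE \<xi> in lborel. norm (\<psi> \<xi> z * exp (- s n * (norm \<xi>)\<^sup>2 / 2)) \<le> g \<xi>" for n
    proof (rule AE_I2)
      fix \<xi> :: 'a
      have "\<bar>\<psi> \<xi> z\<bar> * exp (- s n * (norm \<xi>)\<^sup>2 / 2) \<le> \<bar>\<psi> \<xi> z\<bar> * 1"
        using s[of n] by (intro mult_left_mono) auto
      then show "norm (\<psi> \<xi> z * exp (- s n * (norm \<xi>)\<^sup>2 / 2)) \<le> g \<xi>"
        using \<psi>_le[of \<xi> z] by (simp add: abs_mult)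
    qed
  qed (use g in auto)
  have f0: "f z \<ge> 0" for z
    by (rule LIMSEQ_le_const[OF F_lim]) (auto simp: Fn)
  have cont: "continuous_on UNIV f"
  proof (rule continuous_on_sequentiallyI)
    fix u a assume u: "u \<longlonglongrightarrow> (a::'a)"
    have "(\<lambda>n. \<psi> \<xi> (u n)) \<longlonglongrightarrow> \<psi> \<xi> a" for \<xi>
      unfolding \<psi>_def
      by (rule integral_dominated_convergence[where w="\<lambda>_. 1"])
         (auto intro!: tendsto_intros u)
    then show "(\<lambda>n. f (u n)) \<longlonglongrightarrow> f a"
      unfolding f_def
      by (intro tendsto_mult tendsto_const integral_dominated_convergence[where w=g])
         (use g \<psi>_le in auto)
  qed
  have fm[measurable]: "f \<in> borel_measurable borel"
    using cont by (rule borel_measurable_continuous_onI)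
  define K where "K = c * (\<integral>\<xi>. g \<xi> \<partial>lborel)"
  have FK: "F n z \<le> K" for n z
    unfolding F_def K_def
  proof (intro mult_left_mono integral_mono')
    fix \<xi> :: 'a
    have "\<psi> \<xi> z * exp (- s n * (norm \<xi>)\<^sup>2 / 2) \<le> \<bar>\<psi> \<xi> z\<bar> * 1"
      using s[of n] by (intro mult_mono) auto
    then show "\<psi> \<xi> z * exp (- s n * (norm \<xi>)\<^sup>2 / 2) \<le> g \<xi>"
      using \<psi>_le[of \<xi> z] by simp
    show "0 \<le> g \<xi>" using \<psi>_le[of \<xi> z] by linarith
  qed (use g c in auto)
  define H where "H v = c * sqrt (2 * pi) ^ d * exp (- (norm (v::'a))\<^sup>2 / 2)" for v
  have Hn: "H v \<ge> 0" for v using c by (simp add: H_def)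
  have [measurable]: "H \<in> borel_measurable borel" unfolding H_def by measurable
  have H1: "(\<integral>\<^sup>+v. ennreal (H v) \<partial>lborel) = 1"
  proof -
    have i: "integrable lborel H" unfolding H_def
      using gaussian_integrable(1)[of 1, where 'a='a] by (intro integrable_mult_right) simp
    have "(\<integral>v. H v \<partial>lborel) = c * sqrt (2 * pi) ^ d * sqrt (2 * pi) ^ d"
      unfolding H_def d_def using gaussian_integrable(2)[of 1, where 'a='a] by simp
    also have "\<dots> = c * (sqrt (2 * pi) * sqrt (2 * pi)) ^ d"
      unfolding power_mult_distrib by (rule mult.assoc)
    also have "\<dots> = 1" unfolding c_def by simp
    finally show ?thesis using nn_integral_eq_integral[OF i] Hn by simp
  qed
  \<comment> \<open>Substituting \<open>z = x + sqrt (s n) *\<^sub>R v\<close> puts the dependence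
    on \<open>n\<close> into the indicator alone, against the fixed standard normal density
    \<open>H\<close>.\<close>
  have shift: "(\<integral>\<^sup>+z. indicator U z * ennreal (G n (z - x)) \<partial>lborel)
      = (\<integral>\<^sup>+v. indicator U (x + sqrt (s n) *\<^sub>R v) * ennreal (H v) \<partial>lborel)" if [measurable]: "U \<in> sets borel" for U n x
  proof -
    have "(\<integral>\<^sup>+z. indicator U z * ennreal (G n (z - x)) \<partial>lborel)
      = (\<integral>\<^sup>+z. indicator U z * ennreal (G n (z - x)) \<partial>(density (distr lborel borel (\<lambda>v. x + sqrt (s n) *\<^sub>R v)) (\<lambda>_. \<bar>sqrt (s n)\<bar> ^ DIM('a))))"
      using s[of n] by (subst lborel_affine[of "sqrt (s n)" x]) auto
    also have "\<dots> = (\<integral>\<^sup>+v. ennreal (\<bar>sqrt (s n)\<bar> ^ DIM('a)) * (indicator U (x + sqrt (s n) *\<^sub>R v) * ennreal (G n (sqrt (s n) *\<^sub>R v))) \<partial>lborel)"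
      by (subst nn_integral_density; (subst nn_integral_distr)?; simp)
    also have "\<dots> = (\<integral>\<^sup>+v. indicator U (x + sqrt (s n) *\<^sub>R v) * ennreal (H v) \<partial>lborel)"
    proof (rule nn_integral_cong)
      fix v :: 'a
      have "\<bar>sqrt (s n)\<bar> ^ d * G n (sqrt (s n) *\<^sub>R v) = H v"
        using s[of n] by (simp add: G_def H_def power_mult_distrib real_sqrt_divide power_divide)
      then have "ennreal (\<bar>sqrt (s n)\<bar> ^ DIM('a)) * ennreal (G n (sqrt (s n) *\<^sub>R v)) = ennreal (H v)"
        using s[of n] by (simp add: Gn d_def flip: ennreal_mult)
      then show "ennreal (\<bar>sqrt (s n)\<bar> ^ DIM('a)) * (indicator U (x + sqrt (s n) *\<^sub>R v) * ennreal (G n (sqrt (s n) *\<^sub>R v)))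
         = indicator U (x + sqrt (s n) *\<^sub>R v) * ennreal (H v)"
        by (metis mult.left_commute)
    qed
    finally show ?thesis .
  qed
  have intF: "(\<integral>\<^sup>+z. indicator U z * ennreal (F n z) \<partial>lborel)
      = (\<integral>\<^sup>+x. (\<integral>\<^sup>+v. indicator U (x + sqrt (s n) *\<^sub>R v) * ennreal (H v) \<partial>lborel) \<partial>N)"
    if [measurable]: "U \<in> sets borel" for U n
  proof -
    have "(\<integral>\<^sup>+z. indicator U z * ennreal (F n z) \<partial>lborel)
      = (\<integral>\<^sup>+z. (\<integral>\<^sup>+x. indicator U z * ennreal (G n (z - x)) \<partial>N) \<partial>lborel)"
      unfolding F_eq
      by (intro nn_integral_cong) (subst nn_integral_eq_integral[OF intG, symmetric], auto simp: Gn nn_integral_cmult)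
    also have "\<dots> = (\<integral>\<^sup>+x. (\<integral>\<^sup>+z. indicator U z * ennreal (G n (z - x)) \<partial>lborel) \<partial>N)"
      by (rule Fubini') measurable
    finally show ?thesis unfolding shift[OF that] .
  qed
  \<comment> \<open>For \<open>x\<close> in the open set \<open>U\<close> the point
    \<open>x + sqrt (s n) *\<^sub>R v\<close> eventually lies in \<open>U\<close>, so Fatou applies
    in \<open>v\<close> and then in \<open>x\<close>.\<close>
  have fatou: "emeasure N U \<le> liminf (\<lambda>n. \<integral>\<^sup>+z. indicator U z * ennreal (F n z) \<partial>lborel)" if U: "open U" for U
  proof -
    have [measurable]: "U \<in> sets borel" using U by simp
    have pw: "indicator U x * ennreal (H v) \<le> liminf (\<lambda>n. indicator U (x + sqrt (s n) *\<^sub>R v) * ennreal (H v))" for x v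
    proof (cases "x \<in> U")
      case True
      have "(\<lambda>n. x + sqrt (s n) *\<^sub>R v) \<longlonglongrightarrow> x + sqrt 0 *\<^sub>R v" by (intro tendsto_intros s0)
      then have "eventually (\<lambda>n. x + sqrt (s n) *\<^sub>R v \<in> U) sequentially"
        using U True by (auto dest: topological_tendstoD)
      then show ?thesis using True
        by (intro Liminf_bounded) (auto elim!: eventually_mono)
    qed simp
    have "emeasure N U = (\<integral>\<^sup>+x. indicator U x * (\<integral>\<^sup>+v. ennreal (H v) \<partial>lborel) \<partial>N)"
      unfolding H1 by simp
    also have "\<dots> = (\<integral>\<^sup>+x. (\<integral>\<^sup>+v. indicator U x * ennreal (H v) \<partial>lborel) \<partial>N)"
      by (simp add: nn_integral_cmult)
    also have "\<dots> \<le> (\<integral>\<^sup>+x. (\<integral>\<^sup>+v. liminf (\<lambda>n. indicator U (x + sqrt (s n) *\<^sub>R v) * ennreal (H v)) \<partial>lborel) \<partial>N)"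
      by (intro nn_integral_mono pw)
    also have "\<dots> \<le> (\<integral>\<^sup>+x. liminf (\<lambda>n. \<integral>\<^sup>+v. indicator U (x + sqrt (s n) *\<^sub>R v) * ennreal (H v) \<partial>lborel) \<partial>N)"
      by (intro nn_integral_mono nn_integral_liminf) measurable
    also have "\<dots> \<le> liminf (\<lambda>n. \<integral>\<^sup>+x. (\<integral>\<^sup>+v. indicator U (x + sqrt (s n) *\<^sub>R v) * ennreal (H v) \<partial>lborel) \<partial>N)"
      by (intro nn_integral_liminf) measurable
    finally show ?thesis unfolding intF[OF \<open>U \<in> sets borel\<close>] .
  qed
  define D where "D = density lborel (\<lambda>z. ennreal (f z))"
  have sets_D: "sets D = sets borel" by (simp add: D_def)
  have D_eq: "emeasure D A = (\<integral>\<^sup>+z. indicator A z * ennreal (f z) \<partial>lborel)" if "A \<in> sets borel" for A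
    using that unfolding D_def by (subst emeasure_density) (auto simp: mult.commute)
  \<comment> \<open>On a bounded set the uniform bound \<open>F n z \<le> K\<close> is an integrable
    majorant, so the lower limit is an actual limit. General open sets are then exhausted by
    balls.\<close>
  have bdd: "emeasure N U \<le> emeasure D U" if U: "open U" "bounded U" for U
  proof -
    have [measurable]: "U \<in> sets borel" using U by simp
    have "(\<lambda>n. \<integral>\<^sup>+z. indicator U z * ennreal (F n z) \<partial>lborel) \<longlonglongrightarrow> (\<integral>\<^sup>+z. indicator U z * ennreal (f z) \<partial>lborel)"
    proof (rule nn_integral_dominated_convergence[where w="\<lambda>z. ennreal K * indicator U z"])
      show "AE z in lborel. indicator U z * ennreal (F n z) \<le> ennreal K * indicator U z" for n
        by (intro AE_I2) (auto simp: indicator_def FK intro!: ennreal_leI)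
      show "(\<integral>\<^sup>+z. ennreal K * indicator U z \<partial>lborel) < \<infinity>"
        using emeasure_bounded_finite[OF U(2)] by (simp add: nn_integral_cmult ennreal_mult_less_top)
      show "AE z in lborel. (\<lambda>n. indicator U z * ennreal (F n z)) \<longlonglongrightarrow> indicator U z * ennreal (f z)"
        by (intro AE_I2) (auto simp: indicator_def F_lim)
    qed auto
    then have "liminf (\<lambda>n. \<integral>\<^sup>+z. indicator U z * ennreal (F n z) \<partial>lborel) = emeasure D U"
      unfolding D_eq[OF \<open>U \<in> sets borel\<close>] by (intro lim_imp_Liminf) auto
    then show ?thesis using fatou[OF U(1)] by simp
  qed
  have opn: "emeasure N U \<le> emeasure D U" if U: "open U" for U
  proof -
    have eq: "(\<Union>n. U \<inter> ball 0 (real n)) = U"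
      using reals_Archimedean2 by auto
    have "(SUP n. emeasure N (U \<inter> ball 0 (real n))) = emeasure N (\<Union>n. U \<inter> ball 0 (real n))"
      using U by (intro SUP_emeasure_incseq) (auto simp: incseq_def sets_N)
    then have "emeasure N U = (SUP n. emeasure N (U \<inter> ball 0 (real n)))" unfolding eq by simp
    also have "\<dots> \<le> emeasure D U"
    proof (rule SUP_least)
      fix n :: nat
      have "emeasure N (U \<inter> ball 0 (real n)) \<le> emeasure D (U \<inter> ball 0 (real n))"
        using U by (intro bdd) auto
      also have "\<dots> \<le> emeasure D U" using U by (intro emeasure_mono) (auto simp: sets_D)
      finally show "emeasure N (U \<inter> ball 0 (real n)) \<le> emeasure D U" .
    qed
    finally show ?thesis .
  qed
  have D1: "emeasure D UNIV \<le> 1"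
  proof -
    have "emeasure D UNIV = (\<integral>\<^sup>+z. liminf (\<lambda>n. ennreal (F n z)) \<partial>lborel)"
      by (subst D_eq, simp, intro nn_integral_cong) (auto intro!: lim_imp_Liminf[symmetric] F_lim)
    also have "\<dots> \<le> liminf (\<lambda>n. \<integral>\<^sup>+z. ennreal (F n z) \<partial>lborel)"
      by (rule nn_integral_liminf) measurable
    also have "(\<lambda>n. \<integral>\<^sup>+z. ennreal (F n z) \<partial>lborel) = (\<lambda>_. 1)"
      using intF[of UNIV] by (simp add: H1 emeasure_space_1)
    finally show ?thesis by (simp add: Liminf_const)
  qed
  interpret D: finite_measure D
    using D1 by (intro finite_measureI) (auto simp: D_def top_unique)
  have NA: "emeasure N A \<le> emeasure D A" if A: "A \<in> sets borel" for A
  proof -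
    have "emeasure D A = (INF U \<in> {U. A \<subseteq> U \<and> open U}. emeasure D U)"
      by (rule outer_regular) (use sets_D A D.finite_emeasure_space in auto)
    also have "\<dots> \<ge> emeasure N A"
    proof (rule INF_greatest)
      fix U assume "U \<in> {U. A \<subseteq> U \<and> open U}"
      then show "emeasure N A \<le> emeasure D U"
        by (intro order_trans[OF emeasure_mono opn]) (auto simp: sets_N)
    qed
    finally show ?thesis .
  qed
  \<comment> \<open>A strict gain of \<open>D\<close> over \<open>N\<close> on \<open>A\<close>
    would have to be lost on the complement, where \<open>D\<close> also dominates.\<close>
  have "N = D"
  proof (rule measure_eqI)
    show "sets N = sets D" by (simp add: sets_N sets_D)
    fix A assume "A \<in> sets N"
    then have A: "A \<in> sets borel" "- A \<in> sets borel" by (auto simp: sets_N)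
    have "emeasure N A + emeasure N (- A) = 1"
      using A emeasure_space_1 by (subst plus_emeasure) (auto simp: sets_N space_N)
    moreover have "emeasure D A + emeasure D (- A) \<le> 1"
      using A D1 by (subst plus_emeasure) (auto simp: sets_D)
    ultimately have "emeasure D A + emeasure D (- A) \<le> emeasure N A + emeasure N (- A)" by simp
    also have "\<dots> \<le> emeasure N A + emeasure D (- A)" by (intro add_left_mono NA A)
    finally have "emeasure D A \<le> emeasure N A"
      using D.emeasure_finite[of "- A"] by (metis ennreal_add_left_cancel_le add.commute infinity_ennreal_def)
    then show "emeasure N A = emeasure D A" using NA[OF A(1)] by (rule antisym[rotated])
  qed
  then show ?thesis using cont f0 D_def by blast
qed

section \<open>The random series\<close>

lemma prob_space_sign_space: "prob_space sign_space"
  unfolding sign_space_def by (intro prob_space_PiM measure_pmf.prob_space_axioms)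

lemma measurable_sign_component [measurable]: "(\<lambda>a. a n) \<in> borel_measurable sign_space"
  unfolding sign_space_def
  by (rule measurable_compose[OF measurable_component_singleton[where M="\<lambda>_. measure_pmf (pmf_of_set {-1, 1::real})"]]) auto

lemma measurable_signed_series [measurable]: "signed_series l \<in> borel_measurable sign_space"
  unfolding signed_series_def by measurable

lemma prob_space_nu: "prob_space (nu l)"
  unfolding nu_def by (intro prob_space.prob_space_distr prob_space_sign_space) measurable

lemma sets_nu: "sets (nu l) = sets borel"
  by (simp add: nu_def)

lemma AE_sign_space: "AE a in sign_space. \<forall>n. a n \<in> {-1, 1}"
proof -
  have "AE t in measure_pmf (pmf_of_set {-1, 1::real}). t \<in> {-1, 1}"
    by (auto simp: AE_measure_pmf_iff)
  then have "AE a in sign_space. a n \<in> {-1, 1}" for n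
    unfolding sign_space_def
    by (intro AE_PiM_component[where M="\<lambda>_. measure_pmf (pmf_of_set {-1, 1::real})"])
       (auto intro: measure_pmf.prob_space_axioms)
  then show ?thesis by (subst AE_all_countable) blast
qed

lemma signed_series_sums:
  assumes "cmod l < 1" "\<forall>n. a n \<in> {-1, 1}"
  shows "(\<lambda>n. complex_of_real (a n) * l ^ n) sums signed_series l a"
proof -
  have "norm (complex_of_real (a n) * l ^ n) \<le> cmod l ^ n" for n
    using assms(2)[rule_format, of n] by (auto simp: norm_mult norm_power)
  then have "summable (\<lambda>n. complex_of_real (a n) * l ^ n)"
    by (intro summable_comparison_test'[OF summable_geometric]) (use assms in auto)
  then show ?thesis unfolding signed_series_def by (rule summable_sums)
qed

text \<open>The coordinates are independent, and averaging \<open>cis (c * t)\<close> over the two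
  signs leaves \<open>cos c\<close>.\<close>

lemma sign_space_cis:
  "(\<integral>a. cis (\<Sum>n<M. c n * a n) \<partial>sign_space) = complex_of_real (\<Prod>n<M. cos (c n))"
proof -
  let ?P = "\<lambda>_::nat. measure_pmf (pmf_of_set {-1, 1::real})"
  interpret product_prob_space ?P UNIV
    by unfold_locales
  have [measurable]: "(\<lambda>f. \<Prod>n<M. cis (c n * f n)) \<in> borel_measurable (PiM {..<M} ?P)"
    by (intro borel_measurable_prod measurable_compose[OF measurable_component_singleton]) auto
  have "(\<integral>a. cis (\<Sum>n<M. c n * a n) \<partial>sign_space) = (\<integral>a. (\<Prod>n<M. cis (c n * restrict a {..<M} n)) \<partial>PiM UNIV ?P)"
    unfolding sign_space_def
    by (intro Bochner_Integration.integral_cong) (auto simp: cis_conv_exp exp_sum sum_distrib_left)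
  also have "\<dots> = (\<integral>f. (\<Prod>n<M. cis (c n * f n)) \<partial>distr (PiM UNIV ?P) (PiM {..<M} ?P) (\<lambda>a. restrict a {..<M}))"
    by (subst integral_distr) (auto intro!: measurable_restrict_subset)
  also have "\<dots> = (\<integral>f. (\<Prod>n<M. cis (c n * f n)) \<partial>PiM {..<M} ?P)"
    by (subst distr_PiM_restrict_finite) auto
  also have "\<dots> = (\<Prod>n<M. \<integral>t. cis (c n * t) \<partial>measure_pmf (pmf_of_set {-1, 1}))"
    by (rule product_integral_prod)
       (auto intro!: measure_pmf.integrable_const_bound[where B=1])
  also have "\<dots> = (\<Prod>n<M. complex_of_real (cos (c n)))"
    by (intro prod.cong refl, subst integral_measure_pmf[of "{-1, 1}"]) (auto simp: complex_eq_iff)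
  finally show ?thesis by simp
qed

text \<open>For a partial sum the integral is exactly \<open>cos (\<xi> \<bullet> z)\<close> times a
  product of cosines, since the characteristic function of a symmetric law is real. Dominated
  convergence passes to the series; all factors with \<open>n \<ge> N\<close> are bounded by
  1.\<close>

lemma nu_cos_bound:
  assumes l: "cmod l < 1"
  shows "\<bar>\<integral>x. cos (\<xi> \<bullet> (z - x)) \<partial>nu l\<bar> \<le> (\<Prod>n<N. \<bar>cos (\<xi> \<bullet> l ^ n)\<bar>)"
proof -
  interpret prob_space sign_space by (rule prob_space_sign_space)
  define S where "S M a = (\<Sum>n<M. complex_of_real (a n) * l ^ n)" for M :: nat and a :: "nat \<Rightarrow> real"
  have Sm[measurable]: "S M \<in> borel_measurable sign_space" for M unfolding S_def by measurable
  have fin: "(\<integral>a. cos (\<xi> \<bullet> (z - S M a)) \<partial>sign_space) = cos (\<xi> \<bullet> z) * (\<Prod>n<M. cos (\<xi> \<bullet> l ^ n))" for M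
  proof -
    have eq: "cos (\<xi> \<bullet> (z - S M a)) = Re (cis (\<xi> \<bullet> z) * cis (\<Sum>n<M. - (\<xi> \<bullet> l ^ n) * a n))" for a
    proof -
      have "\<xi> \<bullet> (of_real (a n) * l ^ n) = (\<xi> \<bullet> l ^ n) * a n" for n
        by (simp flip: scaleR_conv_of_real)
      then have "\<xi> \<bullet> (z - S M a) = \<xi> \<bullet> z + (\<Sum>n<M. - (\<xi> \<bullet> l ^ n) * a n)"
        by (simp add: S_def inner_diff_right inner_sum_right sum_negf)
      then show ?thesis unfolding cis_mult by simp
    qed
    have int: "integrable sign_space (\<lambda>a. cis (\<xi> \<bullet> z) * cis (\<Sum>n<M. - (\<xi> \<bullet> l ^ n) * a n))"
      unfolding cis_mult by (rule integrable_const_bound[where B=1]) (auto simp: cis_conv_exp)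
    have "(\<integral>a. cos (\<xi> \<bullet> (z - S M a)) \<partial>sign_space) = Re (\<integral>a. cis (\<xi> \<bullet> z) * cis (\<Sum>n<M. - (\<xi> \<bullet> l ^ n) * a n) \<partial>sign_space)"
      unfolding eq using int by (rule integral_Re)
    also have "\<dots> = Re (cis (\<xi> \<bullet> z) * complex_of_real (\<Prod>n<M. cos (\<xi> \<bullet> l ^ n)))"
      using sign_space_cis[where M=M and c="\<lambda>n. - (\<xi> \<bullet> l ^ n)"] by (simp only: integral_mult_right_zero cos_minus)
    finally show ?thesis by (simp del: of_real_prod)
  qed
  have "(\<lambda>M. \<integral>a. cos (\<xi> \<bullet> (z - S M a)) \<partial>sign_space) \<longlonglongrightarrow> (\<integral>a. cos (\<xi> \<bullet> (z - signed_series l a)) \<partial>sign_space)"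
  proof (rule integral_dominated_convergence[where w="\<lambda>_. 1"])
    show "AE a in sign_space. (\<lambda>M. cos (\<xi> \<bullet> (z - S M a))) \<longlonglongrightarrow> cos (\<xi> \<bullet> (z - signed_series l a))"
      using AE_sign_space
    proof eventually_elim
      case (elim a)
      then have "(\<lambda>M. S M a) \<longlonglongrightarrow> signed_series l a"
        using signed_series_sums[OF l, of a] by (simp add: sums_def S_def)
      then show ?case by (intro tendsto_intros)
    qed
  qed auto
  also have "(\<integral>a. cos (\<xi> \<bullet> (z - signed_series l a)) \<partial>sign_space) = (\<integral>x. cos (\<xi> \<bullet> (z - x)) \<partial>nu l)"
    unfolding nu_def by (subst integral_distr) auto
  finally have lim: "(\<lambda>M. \<bar>\<integral>a. cos (\<xi> \<bullet> (z - S M a)) \<partial>sign_space\<bar>) \<longlonglongrightarrow> \<bar>\<integral>x. cos (\<xi> \<bullet> (z - x)) \<partial>nu l\<bar>"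
    by (rule tendsto_rabs)
  show ?thesis
  proof (rule LIMSEQ_le_const2[OF lim], intro exI[of _ N] allI impI)
    fix M assume "N \<le> M"
    have "\<bar>\<integral>a. cos (\<xi> \<bullet> (z - S M a)) \<partial>sign_space\<bar> \<le> 1 * (\<Prod>n<M. \<bar>cos (\<xi> \<bullet> l ^ n)\<bar>)"
      unfolding fin abs_mult abs_prod by (intro mult_right_mono prod_nonneg) auto
    also have "\<dots> = (\<Prod>n\<in>{..<M} - {..<N}. \<bar>cos (\<xi> \<bullet> l ^ n)\<bar>) * (\<Prod>n<N. \<bar>cos (\<xi> \<bullet> l ^ n)\<bar>)"
      using \<open>N \<le> M\<close> by (subst prod.subset_diff[of "{..<N}"]) auto
    also have "\<dots> \<le> 1 * (\<Prod>n<N. \<bar>cos (\<xi> \<bullet> l ^ n)\<bar>)"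
      by (intro mult_right_mono prod_le_1 prod_nonneg) auto
    finally show "\<bar>\<integral>a. cos (\<xi> \<bullet> (z - S M a)) \<partial>sign_space\<bar> \<le> (\<Prod>n<N. \<bar>cos (\<xi> \<bullet> l ^ n)\<bar>)" by simp
  qed
qed

section \<open>The support: compactness and interior points\<close>

lemma compact_A_set:
  assumes "cmod l < 1"
  shows "compact (A_set l)"
proof -
  let ?X = "PiE UNIV (\<lambda>_::nat. {-1, 1::real})"
  have X: "compact ?X"
    using compactin_PiE[of "\<lambda>_. euclidean" UNIV "\<lambda>_::nat. {-1, 1::real}"]
    by (simp add: euclidean_product_topology)
  \<comment> \<open>Uniform convergence on the compact space of sign sequences makes the series a
    continuous function of the signs.\<close>
  have "uniform_limit ?X (\<lambda>N a. \<Sum>n<N. complex_of_real (a n) * l ^ n) (signed_series l) sequentially"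
    unfolding signed_series_def
  proof (rule Weierstrass_m_test)
    fix n a assume "a \<in> ?X"
    then have "a n \<in> {-1, 1}" by (auto simp: PiE_def)
    then show "norm (complex_of_real (a n) * l ^ n) \<le> cmod l ^ n"
      by (auto simp: norm_mult norm_power)
  qed (use assms in auto)
  then have "continuous_on ?X (signed_series l)"
    by (rule uniform_limit_theorem[rotated])
       (auto intro!: always_eventually continuous_intros continuous_on_product_then_coordinatewise[OF continuous_on_id])
  then have "compact (signed_series l ` ?X)" using X by (rule compact_continuous_image)
  also have "signed_series l ` ?X = A_set l"
    by (auto simp: A_set_def PiE_def Pi_def)
  finally show ?thesis .
qed

lemma emeasure_nu_A_set:
  assumes "cmod l < 1"
  shows "emeasure (nu l) (- A_set l) = 0"
proof -
  have [measurable]: "A_set l \<in> sets borel"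
    using compact_A_set[OF assms] by (simp add: compact_imp_closed)
  have "AE a in sign_space. signed_series l a \<in> A_set l"
    using AE_sign_space by eventually_elim (auto simp: A_set_def)
  then have "AE x in nu l. x \<in> A_set l"
    unfolding nu_def by (subst AE_distr_iff) auto
  then show ?thesis
    by (subst (asm) AE_iff_measurable[of "- A_set l"]) (auto simp: sets_nu nu_def)
qed

text \<open>The open set where the density is positive is nonempty, as the total mass is 1. Its part
  outside the compact set \<open>A_set l\<close> is open and Lebesgue-null, hence empty, so
  \<open>A_set l\<close> contains an open set.\<close>

lemma good_param_if_continuous_density:
  assumes l: "cmod l < 1"
    and inv: "\<exists>f. continuous_on UNIV f \<and> (\<forall>z. 0 \<le> f z) \<and> nu l = density lborel (\<lambda>z. ennreal (f z))"
  shows "good_param l"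
proof -
  obtain f :: "complex \<Rightarrow> real" where f: "continuous_on UNIV f" "\<And>z. 0 \<le> f z" "nu l = density lborel (\<lambda>z. ennreal (f z))"
    using inv by blast
  have fm[measurable]: "f \<in> borel_measurable borel"
    using f(1) by (rule borel_measurable_continuous_onI)
  have ac: "absolutely_continuous lborel (nu l)"
    unfolding f(3) by (intro absolutely_continuousI_density) auto
  obtain z where z: "f z > 0"
  proof (rule ccontr)
    assume "\<not> thesis"
    then have "f z = 0" for z using that[of z] f(2)[of z] by (auto simp: less_eq_real_def)
    then have "emeasure (nu l) UNIV = 0" unfolding f(3) by (simp add: emeasure_density)
    with prob_space.emeasure_space_1[OF prob_space_nu[of l]] show False
      by (simp add: nu_def)
  qed
  have "open (f -` {0<..})" using f(1) by (intro open_vimage) auto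
  define V where "V = f -` {0<..} - A_set l"
  have V: "open V" unfolding V_def
    using \<open>open (f -` {0<..})\<close> compact_A_set[OF l] by (intro open_Diff) (auto simp: compact_imp_closed)
  have "V = {}"
  proof (rule ccontr)
    assume "V \<noteq> {}"
    have [measurable]: "V \<in> sets borel" using V by simp
    have "emeasure (nu l) V \<le> emeasure (nu l) (- A_set l)"
      using compact_A_set[OF l] by (intro emeasure_mono) (auto simp: V_def sets_nu compact_imp_closed)
    then have "emeasure (nu l) V = 0" using emeasure_nu_A_set[OF l] by simp
    then have "AE x in lborel. ennreal (f x) * indicator V x = 0"
      unfolding f(3) by (simp add: emeasure_density nn_integral_0_iff_AE)
    then have "AE x in lborel. x \<notin> V"
      by eventually_elim (auto simp: V_def indicator_def split: if_splits)
    then have "V \<in> null_sets lborel" by (simp add: AE_iff_null_sets)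
    then have "negligible V" using V by (simp add: negligible_iff_null_sets null_sets_completionI)
    then show False using V \<open>V \<noteq> {}\<close> open_not_negligible by blast
  qed
  then have "f -` {0<..} \<subseteq> A_set l" by (auto simp: V_def)
  then have "z \<in> interior (A_set l)"
    using z \<open>open (f -` {0<..})\<close> by (intro interiorI) auto
  then show ?thesis unfolding good_param_def using ac f by blast
qed

section \<open>Transversality\<close>

text \<open>For \<open>N\<close> at least the degree of \<open>p\<close>, Parseval identifies this
  with the mean of \<open>(cmod (poly p z))\<^sup>2\<close> over the circle of radius
  \<rho>.\<close>

definition wsum :: "real \<Rightarrow> nat \<Rightarrow> complex poly \<Rightarrow> real" where
  "wsum \<rho> N p = (\<Sum>n\<le>N. (cmod (coeff p n) * \<rho> ^ n)\<^sup>2)"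

lemma wsum_nonneg: "wsum \<rho> N p \<ge> 0"
  by (simp add: wsum_def sum_nonneg)

text \<open>On the circle of radius \<rho> the factor
  \<open>[:of_real \<rho>, - cnj a / of_real \<rho>:]\<close> has the same modulus as
  \<open>[:-a, 1:]\<close>; for nonzero \<open>a\<close> its zero is the mirror image of
  \<open>a\<close> in that circle. The coefficient sums differ by a telescoping expression, and
  truncation at \<open>N\<close> leaves only the last term.\<close>

lemma wsum_reflect_partial:
  assumes "\<rho> > 0"
  shows "wsum \<rho> N ([:-a, 1:] * h) = wsum \<rho> N ([:of_real \<rho>, - cnj a / of_real \<rho>:] * h)
           - (cmod (coeff h N))\<^sup>2 * \<rho> ^ (2 * N) * (\<rho>\<^sup>2 - (cmod a)\<^sup>2)"
proof (induction N)
  case 0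
  then show ?case using assms
    by (simp add: wsum_def norm_mult power_mult_distrib algebra_simps)
next
  case (Suc N)
  \<comment> \<open>The identity for one coefficient, with \<open>x\<close> and \<open>y\<close>
    standing for \<open>coeff h N\<close> and \<open>coeff h (Suc N)\<close>; the two correction
    terms are what telescopes.\<close>
  have alg: "(cmod (x - a * y))\<^sup>2 = (cmod (of_real \<rho> * y - cnj a / of_real \<rho> * x))\<^sup>2
      + (cmod x)\<^sup>2 * (1 - (cmod a)\<^sup>2 / \<rho>\<^sup>2) - (cmod y)\<^sup>2 * (\<rho>\<^sup>2 - (cmod a)\<^sup>2)" for x y :: complex
    using assms unfolding cmod_power2
    by (simp add: Re_divide Im_divide power2_eq_square field_simps)
  have "wsum \<rho> (Suc N) ([:-a, 1:] * h) = wsum \<rho> N ([:-a, 1:] * h)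
      + (cmod (coeff h N - a * coeff h (Suc N)))\<^sup>2 * \<rho> ^ (2 * Suc N)"
    by (simp add: wsum_def power_mult_distrib power_mult[symmetric] mult.commute)
  moreover have "wsum \<rho> (Suc N) ([:of_real \<rho>, - cnj a / of_real \<rho>:] * h)
      = wsum \<rho> N ([:of_real \<rho>, - cnj a / of_real \<rho>:] * h)
      + (cmod (of_real \<rho> * coeff h (Suc N) - cnj a / of_real \<rho> * coeff h N))\<^sup>2 * \<rho> ^ (2 * Suc N)"
    by (simp add: wsum_def power_mult_distrib power_mult[symmetric] mult.commute)
  moreover have "\<rho> ^ (2 * Suc N) * (1 - (cmod a)\<^sup>2 / \<rho>\<^sup>2) = \<rho> ^ (2 * N) * (\<rho>\<^sup>2 - (cmod a)\<^sup>2)"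
    using assms by (simp add: power_add field_simps power2_eq_square)
  then have "(cmod x)\<^sup>2 * (1 - (cmod a)\<^sup>2 / \<rho>\<^sup>2) * \<rho> ^ (2 * Suc N)
      = (cmod x)\<^sup>2 * \<rho> ^ (2 * N) * (\<rho>\<^sup>2 - (cmod a)\<^sup>2)" for x :: complex
    by (metis (no_types, lifting) mult.assoc mult.commute)
  note this[of "coeff h N"]
  moreover have dist: "(c + x * e - y * d) * K = c * K + x * e * K - y * K * d" for c x e y d K :: real
    by (simp add: algebra_simps)
  ultimately show ?case
    unfolding Suc.IH alg dist by linarith
qed

lemma wsum_reflect:
  assumes "\<rho> > 0" "coeff h N = 0"
  shows "wsum \<rho> N ([:-a, 1:] * h) = wsum \<rho> N ([:of_real \<rho>, - cnj a / of_real \<rho>:] * h)"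
  using wsum_reflect_partial[OF assms(1), of N a h] assms(2) by simp

lemma wsum_ge_coeff_0: "(cmod (coeff p 0))\<^sup>2 \<le> wsum \<rho> N p"
proof -
  have "(cmod (coeff p 0) * \<rho> ^ 0)\<^sup>2 \<le> wsum \<rho> N p"
    unfolding wsum_def by (intro member_le_sum) auto
  then show ?thesis by simp
qed

text \<open>Jensen's inequality for a polynomial with two double zeros: multiplying by Blaschke factors
  moves the zeros out of the disc of radius \<open>\<rho>\<close> without changing the norm on its boundary.\<close>

lemma wsum_double_zeros:
  assumes "\<rho> > 0" and p: "p = [:-a, 1:]\<^sup>2 * [:-b, 1:]\<^sup>2 * h" and N: "degree h + 3 < N"
  shows "(cmod (coeff p 0))\<^sup>2 * \<rho> ^ 8 \<le> (cmod a * cmod b) ^ 4 * wsum \<rho> N p"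
proof -
  define t where "t c = [:of_real \<rho>, - cnj c / of_real \<rho>:]" for c
  define g where "g c = [:-c, 1:]" for c :: complex
  have dt: "degree (t c) \<le> 1" and dg: "degree (g c) \<le> 1" for c
    by (auto simp: t_def g_def)
  \<comment> \<open>Whenever one factor is reflected, the cofactor is \<open>h\<close> times three
    other linear factors, so its degree stays below \<open>N\<close> and the boundary term
    vanishes.\<close>
  have c0: "coeff (q1 * (q2 * (q3 * h))) N = 0" if "degree q1 \<le> 1" "degree q2 \<le> 1" "degree q3 \<le> 1" for q1 q2 q3 :: "complex poly"
  proof (rule coeff_eq_0)
    have "degree (q1 * (q2 * (q3 * h))) \<le> degree q1 + (degree q2 + (degree q3 + degree h))"
      by (meson add_left_mono degree_mult_le order_trans)
    then show "degree (q1 * (q2 * (q3 * h))) < N" using that N by linarith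
  qed
  have sw: "wsum \<rho> N (g c * q) = wsum \<rho> N (t c * q)" if "coeff q N = 0" for c q
    unfolding g_def t_def using wsum_reflect assms(1) that by blast
  have "p = g a * (g a * (g b * (g b * h)))"
    unfolding p g_def power2_eq_square by (simp only: mult.assoc)
  then have "wsum \<rho> N p = wsum \<rho> N (t a * (g a * (g b * (g b * h))))"
    by (simp only: sw[OF c0[OF dg dg dg]])
  also have "\<dots> = wsum \<rho> N (g a * (t a * (g b * (g b * h))))" by (simp only: mult.left_commute)
  also have "\<dots> = wsum \<rho> N (t a * (t a * (g b * (g b * h))))" by (simp only: sw[OF c0[OF dt dg dg]])
  also have "\<dots> = wsum \<rho> N (g b * (t a * (t a * (g b * h))))" by (simp only: mult.left_commute)
  also have "\<dots> = wsum \<rho> N (t b * (t a * (t a * (g b * h))))" by (simp only: sw[OF c0[OF dt dt dg]])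
  also have "\<dots> = wsum \<rho> N (g b * (t b * (t a * (t a * h))))" by (simp only: mult.left_commute)
  also have "\<dots> = wsum \<rho> N (t b * (t b * (t a * (t a * h))))" by (simp only: sw[OF c0[OF dt dt dt]])
  also have "\<dots> \<ge> (cmod (coeff (t b * (t b * (t a * (t a * h)))) 0))\<^sup>2"
    by (rule wsum_ge_coeff_0)
  also have "coeff (t b * (t b * (t a * (t a * h)))) 0 = of_real \<rho> ^ 4 * coeff h 0"
    by (simp add: t_def coeff_mult power_numeral_reduce)
  finally have 1: "(\<rho> ^ 4 * cmod (coeff h 0))\<^sup>2 \<le> wsum \<rho> N p"
    using assms(1) by (simp add: norm_mult norm_power)
  have "coeff p 0 = a\<^sup>2 * b\<^sup>2 * coeff h 0"
    by (simp add: p coeff_mult power2_eq_square)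
  then have "(cmod (coeff p 0))\<^sup>2 * \<rho> ^ 8 = (cmod a * cmod b) ^ 4 * (\<rho> ^ 4 * cmod (coeff h 0))\<^sup>2"
    by (simp add: norm_mult norm_power power_mult_distrib flip: power_mult)
  also have "\<dots> \<le> (cmod a * cmod b) ^ 4 * wsum \<rho> N p"
    by (intro mult_left_mono 1) auto
  finally show ?thesis .
qed

section \<open>Conjugate double zeros and transversality at a point\<close>

lemma double_zeros_factor:
  fixes p :: "complex poly"
  assumes "a \<noteq> b" "poly p a = 0" "poly (pderiv p) a = 0" "poly p b = 0" "poly (pderiv p) b = 0"
  obtains h where "p = [:-a, 1:]\<^sup>2 * [:-b, 1:]\<^sup>2 * h"
proof -
  obtain q where q: "p = [:-a, 1:] * q" using assms(2) by (auto simp: poly_eq_0_iff_dvd)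
  have "poly q a = 0" using assms(3) by (simp add: q pderiv_mult pderiv_pCons del: mult_pCons_left)
  then obtain r where r: "q = [:-a, 1:] * r" by (auto simp: poly_eq_0_iff_dvd)
  have "poly r b = 0" using assms(1,4) by (simp add: q r)
  then obtain s where s: "r = [:-b, 1:] * s" by (auto simp: poly_eq_0_iff_dvd)
  have "poly s b = 0" using assms(1,5) by (simp add: q r s pderiv_mult pderiv_pCons del: mult_pCons_left)
  then obtain h where h: "s = [:-b, 1:] * h" by (auto simp: poly_eq_0_iff_dvd)
  show thesis by (rule that[of h]) (simp only: q r s h power2_eq_square mult.assoc)
qed

text \<open>Real coefficients give conjugate values at conjugate points. Degrees are unrestricted,
  so all estimates on this class must be uniform in the degree.\<close>

definition unit_polys :: "complex poly set" where
  "unit_polys = {f. coeff f 0 = 1 \<and> (\<forall>n. coeff f n \<in> \<real> \<and> cmod (coeff f n) \<le> 1)}"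

lemma poly_cnj_real:
  assumes "\<And>n. coeff f n \<in> \<real>"
  shows "poly f (cnj z) = cnj (poly f z)"
  using assms by (simp add: poly_altdef Reals_cnj_iff)

text \<open>Hermite interpolation at two nodes, used to correct approximate double zeros into exact
  ones. \<open>A\<close> has a double zero at \<open>b\<close> with \<open>A = 1\<close> and
  derivative \<open>2 / c\<close> at \<open>a\<close>; the linear factor of \<open>e\<close> cancels
  this derivative.\<close>

lemma hermite_basis:
  fixes a b :: complex
  assumes "a \<noteq> b"
  obtains e d where "poly e a = 1" "poly (pderiv e) a = 0" "poly e b = 0" "poly (pderiv e) b = 0"
    "poly d a = 0" "poly (pderiv d) a = 1" "poly d b = 0" "poly (pderiv d) b = 0"
proof -
  define c where "c = a - b"
  have c: "c \<noteq> 0" and a: "a = b + c" using assms by (auto simp: c_def)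
  define A where "A = smult (1 / c\<^sup>2) ([:-b, 1:]\<^sup>2)"
  define e where "e = A * [:1 + 2 * a / c, - 2 / c:]"
  define d where "d = A * [:-a, 1:]"
  have "poly e a = 1" "poly (pderiv e) a = 0" "poly e b = 0" "poly (pderiv e) b = 0"
    "poly d a = 0" "poly (pderiv d) a = 1" "poly d b = 0" "poly (pderiv d) b = 0"
    using c unfolding a by (auto simp: e_def d_def A_def a pderiv_mult pderiv_pCons pderiv_smult power2_eq_square field_simps)
  then show thesis by (rule that)
qed

lemma L2_wsum: "sqrt (wsum \<rho> N p) = L2_set (\<lambda>n. cmod (coeff p n) * \<rho> ^ n) {..N}"
  by (simp add: wsum_def L2_set_def)

lemma wsum_triangle:
  assumes "\<rho> > 0"
  shows "sqrt (wsum \<rho> N (p + q)) \<le> sqrt (wsum \<rho> N p) + sqrt (wsum \<rho> N q)"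
proof -
  have "sqrt (wsum \<rho> N (p + q)) \<le> L2_set (\<lambda>n. cmod (coeff p n) * \<rho> ^ n + cmod (coeff q n) * \<rho> ^ n) {..N}"
    unfolding L2_wsum using assms
    by (intro L2_set_mono) (auto simp flip: ring_distribs intro!: mult_right_mono norm_triangle_ineq)
  also have "\<dots> \<le> sqrt (wsum \<rho> N p) + sqrt (wsum \<rho> N q)"
    unfolding L2_wsum by (rule L2_set_triangle_ineq)
  finally show ?thesis .
qed

lemma wsum_smult: "sqrt (wsum \<rho> N (smult c p)) = cmod c * sqrt (wsum \<rho> N p)"
proof -
  have "wsum \<rho> N (smult c p) = (cmod c)\<^sup>2 * wsum \<rho> N p"
    by (simp add: wsum_def sum_distrib_left norm_mult power_mult_distrib mult_ac)
  then show ?thesis by (simp add: real_sqrt_mult)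
qed

lemma wsum_mono_degree:
  assumes "degree p \<le> N"
  shows "wsum \<rho> N p = wsum \<rho> (degree p) p"
  unfolding wsum_def using assms by (intro sum.mono_neutral_right) (auto simp: coeff_eq_0)

lemma wsum_unit_polys:
  assumes "f \<in> unit_polys" "0 < \<rho>" "\<rho> < 1"
  shows "wsum \<rho> N f \<le> 1 / (1 - \<rho>\<^sup>2)"
proof -
  have r: "\<rho>\<^sup>2 < 1" using assms by (simp add: power_less_one_iff)
  have "wsum \<rho> N f \<le> (\<Sum>n\<le>N. (\<rho>\<^sup>2) ^ n)"
    unfolding wsum_def
  proof (rule sum_mono)
    fix n
    have "(cmod (coeff f n))\<^sup>2 \<le> 1" using assms(1) by (simp add: unit_polys_def power_le_one)
    then have "(cmod (coeff f n))\<^sup>2 * (\<rho> ^ n)\<^sup>2 \<le> 1 * (\<rho> ^ n)\<^sup>2" by (rule mult_right_mono) auto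
    then show "(cmod (coeff f n) * \<rho> ^ n)\<^sup>2 \<le> (\<rho>\<^sup>2) ^ n"
      by (simp add: power_mult_distrib flip: power_mult) (simp add: mult.commute)
  qed
  also have "\<dots> \<le> (\<Sum>n. (\<rho>\<^sup>2) ^ n)"
    using r by (intro sum_le_suminf summable_geometric) auto
  also have "\<dots> = 1 / (1 - \<rho>\<^sup>2)" using r by (intro suminf_geometric) auto
  finally show ?thesis .
qed

text \<open>The constant \<open>2 * 5 powr (-5/8)\<close> arises from maximising \<open>\<rho> ^ 8 * (1 - \<rho>\<^sup>2)\<close>, which happens at \<open>\<rho>\<^sup>2 = 4/5\<close>.\<close>

lemma transversality_at:
  fixes \<mu> :: complex
  assumes "Im \<mu> \<noteq> 0" "cmod \<mu> < 2 * 5 powr (-5/8)"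
  obtains \<delta> where "\<delta> > 0"
    "\<And>f. f \<in> unit_polys \<Longrightarrow> cmod (poly f \<mu>) \<ge> \<delta> \<or> cmod (poly (pderiv f) \<mu>) \<ge> \<delta>"
proof -
  define \<rho> :: real where "\<rho> = sqrt (4/5)"
  have \<rho>: "0 < \<rho>" "\<rho> < 1" "\<rho>\<^sup>2 = 4/5" by (auto simp: \<rho>_def real_sqrt_lt_1_iff)
  have \<rho>4: "\<rho> ^ 4 = 16/25" using power_mult[of \<rho> 2 2] unfolding \<rho>(3) by (simp add: power2_eq_square)
  \<comment> \<open>For exact double zeros at \<mu> and its conjugate, the square root of Jensen's
    bound would read \<open>16/25 \<le> cmod \<mu> ^ 4 * sqrt 5\<close>, with
    \<open>16/25 = \<rho> ^ 4\<close> and \<open>sqrt 5\<close> bounding the norm of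
    \<open>f\<close>. The hypothesis on \<open>cmod \<mu>\<close> contradicts this with room to
    spare.\<close>
  have key: "(cmod \<mu>) ^ 4 * sqrt 5 < 16/25"
  proof -
    have "(cmod \<mu>) ^ 4 < (2 * 5 powr (-5/8)) ^ 4"
      using assms(2) by (intro power_strict_mono) auto
    also have "\<dots> = 16 * 5 powr (-5/2)"
      by (simp add: power_mult_distrib powr_power)
    finally have "(cmod \<mu>) ^ 4 * sqrt 5 < 16 * 5 powr (-5/2) * 5 powr (1/2)"
      by (simp add: powr_half_sqrt)
    also have "\<dots> = 16 * 5 powr (-2)"
      by (simp flip: powr_add)
    also have "\<dots> = 16/25" by (simp add: powr_minus powr_numeral)
    finally show ?thesis .
  qed
  have ne: "\<mu> \<noteq> cnj \<mu>" using assms(1) by (metis Reals_cnj_iff complex_is_Real_iff)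
  obtain e d where ed: "poly e \<mu> = 1" "poly (pderiv e) \<mu> = 0" "poly e (cnj \<mu>) = 0" "poly (pderiv e) (cnj \<mu>) = 0"
    "poly d \<mu> = 0" "poly (pderiv d) \<mu> = 1" "poly d (cnj \<mu>) = 0" "poly (pderiv d) (cnj \<mu>) = 0"
    using hermite_basis[OF ne] .
  obtain e' d' where ed': "poly e' (cnj \<mu>) = 1" "poly (pderiv e') (cnj \<mu>) = 0" "poly e' \<mu> = 0" "poly (pderiv e') \<mu> = 0"
    "poly d' (cnj \<mu>) = 0" "poly (pderiv d') (cnj \<mu>) = 1" "poly d' \<mu> = 0" "poly (pderiv d') \<mu> = 0"
    using hermite_basis[OF ne[symmetric]] .
  define W where "W p = sqrt (wsum \<rho> (degree p) p)" for p
  define C where "C = W e + W d + W e' + W d'"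
  have Wn: "W p \<ge> 0" for p unfolding W_def by (simp add: wsum_nonneg)
  have C: "C \<ge> 0" unfolding C_def by (intro add_nonneg_nonneg Wn)
  \<comment> \<open>If \<open>f\<close> and its derivative are small at \<mu>, they are small at the
    conjugate too. Adding a small Hermite correction \<open>q\<close> creates exact double zeros at
    both points and perturbs Jensen's bound by multiples of \<open>C * \<delta>\<close>, where
    \<open>C\<close> depends on \<mu> but not on \<open>f\<close>.\<close>
  have main: "(1 - C * \<delta>) * (16/25) \<le> cmod \<mu> ^ 4 * (sqrt 5 + C * \<delta>)"
    if f: "f \<in> unit_polys" and small: "cmod (poly f \<mu>) < \<delta>" "cmod (poly (pderiv f) \<mu>) < \<delta>" for f \<delta>
  proof -
    have fr: "coeff f n \<in> \<real>" "coeff (pderiv f) n \<in> \<real>" for n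
      using f by (auto simp: unit_polys_def coeff_pderiv intro: Reals_mult)
    define x y where "x = poly f \<mu>" and "y = poly (pderiv f) \<mu>"
    define q where "q = smult (-x) e + (smult (-y) d + (smult (- cnj x) e' + smult (- cnj y) d'))"
    have z: "poly (f + q) \<mu> = 0" "poly (pderiv (f + q)) \<mu> = 0"
      "poly (f + q) (cnj \<mu>) = 0" "poly (pderiv (f + q)) (cnj \<mu>) = 0"
      by (simp_all add: q_def ed ed' pderiv_add pderiv_smult x_def y_def poly_cnj_real fr
          del: smult_minus_left)
    obtain h where h: "f + q = [:-\<mu>, 1:]\<^sup>2 * [:-cnj \<mu>, 1:]\<^sup>2 * h"
      using double_zeros_factor[OF ne z] .
    \<comment> \<open>Large enough for the double-zero bound and for the truncated sums of all four
      correction polynomials to be complete.\<close>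
    define N where "N = degree h + 4 + degree e + degree d + degree e' + degree d'"
    have WN: "sqrt (wsum \<rho> N e) = W e" "sqrt (wsum \<rho> N d) = W d" "sqrt (wsum \<rho> N e') = W e'" "sqrt (wsum \<rho> N d') = W d'"
      unfolding W_def by (subst wsum_mono_degree; simp add: N_def)+
    have "sqrt (wsum \<rho> N q) \<le> cmod x * W e + (cmod y * W d + (cmod x * W e' + cmod y * W d'))"
      using wsum_triangle[OF \<rho>(1), of N "smult (-x) e" "smult (-y) d + (smult (- cnj x) e' + smult (- cnj y) d')"]
        wsum_triangle[OF \<rho>(1), of N "smult (-y) d" "smult (- cnj x) e' + smult (- cnj y) d'"]
        wsum_triangle[OF \<rho>(1), of N "smult (- cnj x) e'" "smult (- cnj y) d'"]
      unfolding q_def wsum_smult WN by simp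
    also have "\<dots> \<le> \<delta> * W e + (\<delta> * W d + (\<delta> * W e' + \<delta> * W d'))"
      using small unfolding x_def y_def by (intro add_mono mult_right_mono Wn) auto
    also have "\<dots> = C * \<delta>" by (simp add: C_def algebra_simps)
    finally have q: "sqrt (wsum \<rho> N q) \<le> C * \<delta>" .
    have "sqrt (wsum \<rho> N f) \<le> sqrt 5"
      using wsum_unit_polys[OF f \<rho>(1,2), of N] unfolding \<rho>(3) by simp
    then have fq: "sqrt (wsum \<rho> N (f + q)) \<le> sqrt 5 + C * \<delta>"
      using wsum_triangle[OF \<rho>(1), of N f q] q by linarith
    have "cmod (coeff q 0) \<le> C * \<delta>"
      using q wsum_ge_coeff_0[of q \<rho> N] real_le_rsqrt by fastforce
    moreover have "coeff f 0 = 1" using f by (simp add: unit_polys_def)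
    ultimately have c0: "1 - C * \<delta> \<le> cmod (coeff (f + q) 0)"
      using norm_triangle_ineq4[of "coeff (f + q) 0" "coeff q 0"] by simp
    have "(cmod (coeff (f + q) 0))\<^sup>2 * \<rho> ^ 8 \<le> (cmod \<mu> * cmod (cnj \<mu>)) ^ 4 * wsum \<rho> N (f + q)"
      by (rule wsum_double_zeros[OF \<rho>(1) h]) (simp add: N_def)
    also have "(cmod (coeff (f + q) 0))\<^sup>2 * \<rho> ^ 8 = (cmod (coeff (f + q) 0) * \<rho> ^ 4)\<^sup>2"
      by (simp add: power_mult_distrib flip: power_mult)
    also have "(cmod \<mu> * cmod (cnj \<mu>)) ^ 4 * wsum \<rho> N (f + q) = (cmod \<mu> ^ 4 * sqrt (wsum \<rho> N (f + q)))\<^sup>2"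
      unfolding power_mult_distrib[of _ "sqrt _"] real_sqrt_pow2[OF wsum_nonneg]
      by (simp add: power_mult_distrib power2_eq_square)
    finally have "cmod (coeff (f + q) 0) * \<rho> ^ 4 \<le> cmod \<mu> ^ 4 * sqrt (wsum \<rho> N (f + q))"
      by (rule power2_le_imp_le) (auto simp: wsum_nonneg)
    also have "\<dots> \<le> cmod \<mu> ^ 4 * (sqrt 5 + C * \<delta>)" by (intro mult_left_mono fq) auto
    finally have "cmod (coeff (f + q) 0) * (16/25) \<le> cmod \<mu> ^ 4 * (sqrt 5 + C * \<delta>)"
      unfolding \<rho>4 .
    moreover have "(1 - C * \<delta>) * (16/25) \<le> cmod (coeff (f + q) 0) * (16/25)"
      by (intro mult_right_mono c0) auto
    ultimately show ?thesis by linarith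
  qed
  \<comment> \<open>The gap in \<open>key\<close>; \<open>D\<close> collects the coefficients of
    \<delta> in \<open>main\<close>, so any \<delta> with \<open>D * \<delta> < \<kappa>\<close> is
    contradictory.\<close>
  define \<kappa> where "\<kappa> = 16/25 - cmod \<mu> ^ 4 * sqrt 5"
  define D where "D = C * (16/25) + cmod \<mu> ^ 4 * C"
  have D: "D \<ge> 0" unfolding D_def using C by (intro add_nonneg_nonneg mult_nonneg_nonneg) auto
  define \<delta> where "\<delta> = \<kappa> / (D + 1)"
  have \<kappa>: "\<kappa> > 0" using key by (simp add: \<kappa>_def)
  have pos: "\<delta> > 0" using \<kappa> D by (simp add: \<delta>_def)
  have "D * \<delta> < \<kappa>" using \<kappa> D by (simp add: \<delta>_def field_simps)
  moreover have "\<kappa> \<le> D * \<delta>" if "f \<in> unit_polys" "cmod (poly f \<mu>) < \<delta>" "cmod (poly (pderiv f) \<mu>) < \<delta>" for f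
    using main[OF that] unfolding \<kappa>_def D_def by (simp add: algebra_simps)
  ultimately have "cmod (poly f \<mu>) \<ge> \<delta> \<or> cmod (poly (pderiv f) \<mu>) \<ge> \<delta>" if "f \<in> unit_polys" for f
    using that by (meson not_le)
  then show thesis using that pos by blast
qed

section \<open>From transversality at a point to a uniform alternative on a disc\<close>

lemma norm_poly_le_suminf:
  fixes p :: "complex poly"
  assumes b: "\<And>n. cmod (coeff p n) \<le> b n" and sum: "summable (\<lambda>n. b n * s ^ n)" and z: "cmod z \<le> s"
  shows "cmod (poly p z) \<le> (\<Sum>n. b n * s ^ n)"
proof -
  have s: "0 \<le> s" using z norm_ge_zero order_trans by blast
  have b0: "0 \<le> b n" for n using b[of n] norm_ge_zero order_trans by blast
  have "cmod (poly p z) \<le> (\<Sum>n\<le>degree p. cmod (coeff p n * z ^ n))"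
    unfolding poly_altdef by (rule norm_sum)
  also have "\<dots> \<le> (\<Sum>n\<le>degree p. b n * s ^ n)"
    unfolding norm_mult norm_power using z b b0 s by (intro sum_mono mult_mono power_mono) auto
  also have "\<dots> \<le> (\<Sum>n. b n * s ^ n)"
    using b0 s by (intro sum_le_suminf sum) auto
  finally show ?thesis .
qed

text \<open>The coefficients of \<open>f\<close> are dominated by those of the geometric series, and
  termwise differentiation (\<open>diffs\<close>) preserves both the domination and convergence
  inside the unit disc. Hence the bounds do not depend on the degree.\<close>

lemma unit_polys_deriv_bound:
  assumes "s < 1"
  obtains B where "B > 0"
    "\<And>f z. f \<in> unit_polys \<Longrightarrow> cmod z \<le> s \<Longrightarrow> cmod (poly (pderiv f) z) \<le> B"
    "\<And>f z. f \<in> unit_polys \<Longrightarrow> cmod z \<le> s \<Longrightarrow> cmod (poly (pderiv (pderiv f)) z) \<le> B"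
proof -
  have g: "summable (\<lambda>n. (\<lambda>_. 1 :: real) n * x ^ n)" if "norm x < 1" for x :: real
    using that by (simp add: summable_geometric)
  have d1: "summable (\<lambda>n. diffs (\<lambda>_. 1) n * x ^ n)" if "norm x < 1" for x :: real
    using termdiff_converges[OF that g] by simp
  have d2: "summable (\<lambda>n. diffs (diffs (\<lambda>_. 1)) n * x ^ n)" if "norm x < 1" for x :: real
    using termdiff_converges[OF that d1] by simp
  define S1 where "S1 = (\<Sum>n. diffs (\<lambda>_. 1) n * s ^ n)"
  define S2 where "S2 = (\<Sum>n. diffs (diffs (\<lambda>_. 1)) n * s ^ n)"
  have c1: "cmod (coeff (pderiv f) n) \<le> diffs (\<lambda>_. 1) n" if "f \<in> unit_polys" for f n
  proof -
    have "cmod (coeff f (Suc n)) \<le> 1" using that by (simp add: unit_polys_def)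
    then have "real (Suc n) * cmod (coeff f (Suc n)) \<le> real (Suc n) * 1" by (intro mult_left_mono) auto
    then show ?thesis unfolding coeff_pderiv norm_mult norm_of_nat diffs_def by simp
  qed
  have c2: "cmod (coeff (pderiv (pderiv f)) n) \<le> diffs (diffs (\<lambda>_. 1)) n" if "f \<in> unit_polys" for f n
    unfolding coeff_pderiv[of "pderiv f"] norm_mult norm_of_nat diffs_def[of "diffs _"]
    by (intro mult_left_mono c1 that) auto
  have 1: "cmod (poly (pderiv f) z) \<le> S1" if "f \<in> unit_polys" "cmod z \<le> s" for f z
  proof -
    have "norm s < 1" using assms order_trans[OF norm_ge_zero that(2)] by simp
    then show ?thesis unfolding S1_def using c1 d1 that by (intro norm_poly_le_suminf) auto
  qed
  have 2: "cmod (poly (pderiv (pderiv f)) z) \<le> S2" if "f \<in> unit_polys" "cmod z \<le> s" for f z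
  proof -
    have "norm s < 1" using assms order_trans[OF norm_ge_zero that(2)] by simp
    then show ?thesis unfolding S2_def using c2 d2 that by (intro norm_poly_le_suminf) auto
  qed
  show thesis
    by (rule that[of "1 + \<bar>S1\<bar> + \<bar>S2\<bar>"]) (use 1 2 in \<open>fastforce+\<close>)
qed

text \<open>\<open>x ^ k - y ^ k\<close> is \<open>x - y\<close> times a continuous function
  \<open>H (x, y)\<close>, whose value \<open>of_nat k * a ^ (k - 1)\<close> at
  \<open>(a, a)\<close> is nonzero.\<close>

lemma power_lower_lipschitz:
  fixes a :: complex
  assumes "a \<noteq> 0" "k \<ge> 1"
  obtains \<eta> c where "\<eta> > 0" "c > 0"
    "\<And>x y. x \<in> cball a \<eta> \<Longrightarrow> y \<in> cball a \<eta> \<Longrightarrow> c * cmod (x - y) \<le> cmod (x ^ k - y ^ k)"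
proof -
  define H where "H p = (\<Sum>i<k. snd p ^ (k - Suc i) * fst p ^ i)" for p :: "complex \<times> complex"
  have Ha: "H (a, a) = of_nat k * a ^ (k - 1)"
    by (simp add: H_def flip: power_add)
  define c where "c = cmod (H (a, a)) / 2"
  have c: "c > 0" using assms by (simp add: c_def Ha)
  have "continuous_on UNIV H" unfolding H_def by (intro continuous_intros)
  then have "isCont H (a, a)" by (simp add: continuous_on_eq_continuous_at)
  then obtain e where e: "e > 0" "\<And>p. dist p (a, a) < e \<Longrightarrow> dist (H p) (H (a, a)) < c"
    unfolding continuous_at_eps_delta using c by blast
  show thesis
  proof (rule that[of "e / 3" c])
    fix x y assume xy: "x \<in> cball a (e / 3)" "y \<in> cball a (e / 3)"
    have "dist (x, y) (a, a) \<le> dist x a + dist y a"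
      unfolding dist_Pair_Pair by (rule sqrt_sum_squares_le_sum) auto
    also have "\<dots> < e" using xy e(1) by (simp add: dist_commute)
    finally have "dist (H (x, y)) (H (a, a)) < c" by (rule e(2))
    then have "c \<le> cmod (H (x, y))"
      using norm_triangle_ineq2[of "H (a, a)" "H (x, y)"] unfolding dist_norm c_def
      by (simp add: norm_minus_commute)
    then have "c * cmod (x - y) \<le> cmod (x - y) * cmod (H (x, y))"
      by (subst mult.commute) (intro mult_left_mono, auto)
    also have "\<dots> = cmod (x ^ k - y ^ k)"
      by (simp add: power_diff_sumr2 H_def norm_mult)
    finally show "c * cmod (x - y) \<le> cmod (x ^ k - y ^ k)" .
  qed (use e c in auto)
qed

lemma transversality_radius_lt_1: "2 * (5::real) powr (-5/8) < 1"
proof -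
  have "2 < sqrt (5::real)" by (rule real_less_rsqrt) simp
  also have "sqrt 5 = (5::real) powr (1/2)" by (simp add: powr_half_sqrt)
  also have "\<dots> < 5 powr (5/8)" by simp
  finally have "2 < (5::real) powr (5/8)" .
  moreover have "(5::real) powr (-5/8) = 1 / 5 powr (5/8)"
    using powr_minus_divide[of 5 "5/8 :: real"] by simp
  ultimately show ?thesis by simp
qed

text \<open>The uniform derivative bounds spread transversality from \<open>a ^ k\<close> to a disc
  whose radius is independent of \<open>f\<close>. The second alternative is a lower Lipschitz bound
  in the parameter itself, the power map included, which is the form needed for the Gaussian
  average.\<close>

lemma local_transversality:
  fixes a :: complex
  assumes k: "k \<ge> 1" and Im: "Im (a ^ k) \<noteq> 0" and up: "cmod (a ^ k) < 2 * 5 powr (-5/8)"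
    and lo: "1 / 2 < (cmod (a ^ k))\<^sup>2"
  obtains \<eta> c \<rho> where "\<eta> > 0" "c > 0" "\<rho> > 0" "1 / 2 < \<rho>\<^sup>2"
    "\<And>l. l \<in> cball a \<eta> \<Longrightarrow> \<rho> \<le> cmod l ^ k"
    "\<And>l. l \<in> cball a \<eta> \<Longrightarrow> cmod l < 1"
    "\<And>f. f \<in> unit_polys \<Longrightarrow> (\<forall>l\<in>cball a \<eta>. c \<le> cmod (poly f (l ^ k)))
        \<or> (\<forall>l\<in>cball a \<eta>. \<forall>m\<in>cball a \<eta>. c * cmod (l - m) \<le> cmod (poly f (l ^ k) - poly f (m ^ k)))"
proof -
  define \<mu> where "\<mu> = a ^ k"
  have a0: "a \<noteq> 0" using Im k by (auto simp: power_0_left)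
  obtain \<delta> where \<delta>: "\<delta> > 0"
    "\<And>f. f \<in> unit_polys \<Longrightarrow> cmod (poly f \<mu>) \<ge> \<delta> \<or> cmod (poly (pderiv f) \<mu>) \<ge> \<delta>"
    using transversality_at[of \<mu>] Im up unfolding \<mu>_def by blast
  have "cmod \<mu> < 1" using up transversality_radius_lt_1 by (simp add: \<mu>_def)
  then obtain s where s: "cmod \<mu> < s" "s < 1" using dense by blast
  have "sqrt (1/2) < cmod \<mu>" using lo by (intro real_less_lsqrt) (auto simp: \<mu>_def)
  then obtain \<rho> where \<rho>: "sqrt (1/2) < \<rho>" "\<rho> < cmod \<mu>" using dense by blast
  have \<rho>0: "\<rho> > 0" using \<rho>(1) real_sqrt_gt_zero[of "1/2"] by linarith
  have \<rho>2: "1 / 2 < \<rho>\<^sup>2" using power_strict_mono[OF \<rho>(1), of 2] by simp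
  obtain B where B: "B > 0"
    "\<And>f z. f \<in> unit_polys \<Longrightarrow> cmod z \<le> s \<Longrightarrow> cmod (poly (pderiv f) z) \<le> B"
    "\<And>f z. f \<in> unit_polys \<Longrightarrow> cmod z \<le> s \<Longrightarrow> cmod (poly (pderiv (pderiv f)) z) \<le> B"
    using unit_polys_deriv_bound[OF s(2)] by blast
  \<comment> \<open>The three entries keep the disc inside radius \<open>s\<close>, outside radius
    \<rho>, and small enough that \<open>f\<close> and its derivative vary by at most
    \<open>\<delta> / 2\<close>.\<close>
  define r where "r = Min {s - cmod \<mu>, cmod \<mu> - \<rho>, \<delta> / (2 * B)}"
  have r: "r > 0" "r \<le> s - cmod \<mu>" "r \<le> cmod \<mu> - \<rho>" "r \<le> \<delta> / (2 * B)"
    using s \<rho> \<delta> B unfolding r_def by auto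
  have Br: "B * r \<le> \<delta> / 2" using r(4) B(1) by (simp add: field_simps)
  have zs: "cmod z \<le> s" "\<rho> \<le> cmod z" if "z \<in> cball \<mu> r" for z
    using that r norm_triangle_ineq2[of z \<mu>] norm_triangle_ineq2[of \<mu> z]
    by (auto simp: dist_norm norm_minus_commute)
  obtain \<eta>1 c1 where c1: "\<eta>1 > 0" "c1 > 0"
    "\<And>x y. x \<in> cball a \<eta>1 \<Longrightarrow> y \<in> cball a \<eta>1 \<Longrightarrow> c1 * cmod (x - y) \<le> cmod (x ^ k - y ^ k)"
    using power_lower_lipschitz[OF a0 k] by blast
  have "isCont (\<lambda>l. l ^ k) a" by simp
  then obtain \<eta>2 where \<eta>2: "\<eta>2 > 0" "\<And>l. dist l a < \<eta>2 \<Longrightarrow> dist (l ^ k) (a ^ k) < r"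
    unfolding continuous_at_eps_delta using r(1) by blast
  define \<eta> where "\<eta> = min \<eta>1 (\<eta>2 / 2)"
  have \<eta>: "\<eta> > 0" using c1 \<eta>2 by (simp add: \<eta>_def)
  have pw: "l ^ k \<in> cball \<mu> r" and e1: "l \<in> cball a \<eta>1" if "l \<in> cball a \<eta>" for l
    using that \<eta>2(2)[of l] \<eta>2(1) by (auto simp: \<eta>_def \<mu>_def dist_commute)
  define c where "c = min (\<delta> / 2) (\<delta> / 2 * c1)"
  have c: "c > 0" using \<delta>(1) c1(2) by (simp add: c_def)
  have main: "(\<forall>l\<in>cball a \<eta>. c \<le> cmod (poly f (l ^ k)))
        \<or> (\<forall>l\<in>cball a \<eta>. \<forall>m\<in>cball a \<eta>. c * cmod (l - m) \<le> cmod (poly f (l ^ k) - poly f (m ^ k)))"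
    if f: "f \<in> unit_polys" for f
  proof -
    have L1: "cmod (poly f z - poly f \<mu>) \<le> B * cmod (z - \<mu>)" if z: "z \<in> cball \<mu> r" for z
      by (rule field_differentiable_bound[of "cball \<mu> r" _ "poly (pderiv f)"])
         (use z r(1) B(2)[OF f] zs in \<open>auto intro: poly_DERIV[THEN DERIV_subset]\<close>)
    have L2: "cmod (poly (pderiv f) z - poly (pderiv f) \<mu>) \<le> B * cmod (z - \<mu>)" if z: "z \<in> cball \<mu> r" for z
      by (rule field_differentiable_bound[of "cball \<mu> r" _ "poly (pderiv (pderiv f))"])
         (use z r(1) B(3)[OF f] zs in \<open>auto intro: poly_DERIV[THEN DERIV_subset]\<close>)
    have ball: "B * cmod (z - \<mu>) \<le> \<delta> / 2" if z: "z \<in> cball \<mu> r" for z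
    proof -
      have "B * cmod (z - \<mu>) \<le> B * r" using z B(1) by (intro mult_left_mono) (auto simp: dist_norm norm_minus_commute)
      with Br show ?thesis by linarith
    qed
    show ?thesis
    proof (cases "cmod (poly f \<mu>) \<ge> \<delta>")
      case True
      have "c \<le> cmod (poly f (l ^ k))" if "l \<in> cball a \<eta>" for l
        using L1[OF pw[OF that]] ball[OF pw[OF that]] True norm_triangle_ineq3[of "poly f (l ^ k)" "poly f \<mu>"]
        unfolding c_def by linarith
      then show ?thesis by blast
    next
      case False
      then have D: "cmod (poly (pderiv f) \<mu>) \<ge> \<delta>" using \<delta>(2)[OF f] by blast
      have "c * cmod (l - m) \<le> cmod (poly f (l ^ k) - poly f (m ^ k))" if lm: "l \<in> cball a \<eta>" "m \<in> cball a \<eta>" for l m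
      proof -
        define z w where "z = l ^ k" and "w = m ^ k"
        have zw: "z \<in> cball \<mu> r" "w \<in> cball \<mu> r" using pw lm by (auto simp: z_def w_def)
        \<comment> \<open>Subtracting the linear part at \<mu> leaves a map with derivative at most
          \<open>\<delta> / 2\<close>, so \<open>f\<close> still expands distances by the factor
          \<open>\<delta> - \<delta> / 2\<close>.\<close>
        define h where "h x = poly f x - poly (pderiv f) \<mu> * x" for x
        have "cmod (h z - h w) \<le> \<delta> / 2 * cmod (z - w)"
        proof (rule field_differentiable_bound[of "cball \<mu> r" _ "\<lambda>x. poly (pderiv f) x - poly (pderiv f) \<mu>"])
          show "(h has_field_derivative poly (pderiv f) x - poly (pderiv f) \<mu>) (at x within cball \<mu> r)" for x
            unfolding h_def by (rule derivative_eq_intros poly_DERIV[THEN DERIV_subset] | simp)+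
          show "cmod (poly (pderiv f) x - poly (pderiv f) \<mu>) \<le> \<delta> / 2" if "x \<in> cball \<mu> r" for x
            using L2[OF that] ball[OF that] by linarith
        qed (use zw in auto)
        moreover have "poly f z - poly f w = poly (pderiv f) \<mu> * (z - w) + (h z - h w)"
          by (simp add: h_def algebra_simps)
        then have "cmod (poly (pderiv f) \<mu>) * cmod (z - w) - cmod (h z - h w) \<le> cmod (poly f z - poly f w)"
          by (metis norm_diff_ineq norm_mult)
        moreover have "\<delta> * cmod (z - w) \<le> cmod (poly (pderiv f) \<mu>) * cmod (z - w)"
          by (intro mult_right_mono D) auto
        ultimately have "\<delta> / 2 * cmod (z - w) \<le> cmod (poly f z - poly f w)" by linarith
        moreover have "\<delta> / 2 * (c1 * cmod (l - m)) \<le> \<delta> / 2 * cmod (z - w)"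
          unfolding z_def w_def using \<delta>(1) by (intro mult_left_mono c1(3) e1 lm) auto
        moreover have "c * cmod (l - m) \<le> \<delta> / 2 * c1 * cmod (l - m)"
          by (intro mult_right_mono) (auto simp: c_def)
        ultimately show ?thesis unfolding z_def w_def by linarith
      qed
      then show ?thesis by blast
    qed
  qed
  show thesis
  proof (rule that[OF \<eta> c \<rho>0 \<rho>2 _ _ main])
    fix l assume l: "l \<in> cball a \<eta>"
    show "\<rho> \<le> cmod l ^ k" using zs(2)[OF pw[OF l]] by (simp add: norm_power)
    have "cmod l ^ k < 1" using zs(1)[OF pw[OF l]] s(2) by (simp add: norm_power)
    then show "cmod l < 1" by (metis linorder_not_less one_le_power)
  qed
qed

section \<open>Energy estimates\<close>

lemma gaussian_translate:
  fixes a :: complex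
  assumes "s > 0"
  shows "integrable lborel (\<lambda>x. exp (- s * (cmod (x - a))\<^sup>2 / 2))"
    and "(\<integral>x. exp (- s * (cmod (x - a))\<^sup>2 / 2) \<partial>lborel) = 2 * pi / s"
proof -
  let ?h = "\<lambda>x::complex. exp (- s * (cmod x)\<^sup>2 / 2)"
  have eq: "lborel = distr lborel borel (\<lambda>x. -a + x)"
    by (rule lborel_distr_plus[symmetric])
  have h: "integrable lborel ?h" "integral\<^sup>L lborel ?h = 2 * pi / s"
    using gaussian_integrable[OF assms, where 'a=complex] assms by (simp_all add: real_sqrt_pow2)
  have "integrable (distr lborel borel (\<lambda>x. -a + x)) ?h" unfolding eq[symmetric] by (rule h(1))
  then show "integrable lborel (\<lambda>x. exp (- s * (cmod (x - a))\<^sup>2 / 2))"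
    by (subst (asm) integrable_distr_eq) auto
  have "integral\<^sup>L (distr lborel borel (\<lambda>x. -a + x)) ?h = 2 * pi / s" unfolding eq[symmetric] by (rule h(2))
  then show "(\<integral>x. exp (- s * (cmod (x - a))\<^sup>2 / 2) \<partial>lborel) = 2 * pi / s"
    by (subst (asm) integral_distr) auto
qed

text \<open>The point is that the bound is independent of \<open>s\<close>, which will tend to 0. If
  \<phi> stays away from 0, \<open>exp x \<ge> x\<close> absorbs the factor \<open>1 / s\<close>; if
  \<phi> expands, the integrand is dominated by a Gaussian in the parameter, whose integral is
  proportional to \<open>s\<close>.\<close>

lemma gaussian_set_integral_bound:
  fixes \<phi> :: "complex \<Rightarrow> complex" and a :: complex
  assumes cont: "continuous_on (cball a \<eta>) \<phi>" and c: "c > 0" and y: "y > 0" and s: "s > 0" and \<eta>: "\<eta> > 0"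
    and alt: "(\<forall>l\<in>cball a \<eta>. c \<le> cmod (\<phi> l))
        \<or> (\<forall>l\<in>cball a \<eta>. \<forall>m\<in>cball a \<eta>. c * cmod (l - m) \<le> cmod (\<phi> l - \<phi> m))"
    and \<psi>: "\<And>l. l \<in> cball a \<eta> \<Longrightarrow> 2 * y * cmod (\<phi> l) \<le> cmod (\<psi> l)"
  shows "(\<integral>l. indicator (cball a \<eta>) l * (2 * pi / s * exp (- (cmod (\<psi> l))\<^sup>2 / (2 * s))) \<partial>lborel)
      \<le> (pi * measure lborel (cball a \<eta>) + 4 * pi\<^sup>2) / (c\<^sup>2 * y\<^sup>2)"
  using alt
proof
  assume A: "\<forall>l\<in>cball a \<eta>. c \<le> cmod (\<phi> l)"
  have pw: "2 * pi / s * exp (- (cmod (\<psi> l))\<^sup>2 / (2 * s)) \<le> pi / (c\<^sup>2 * y\<^sup>2)" if l: "l \<in> cball a \<eta>" for l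
  proof -
    have "2 * y * c \<le> 2 * y * cmod (\<phi> l)" using A l y by (intro mult_left_mono) auto
    also have "\<dots> \<le> cmod (\<psi> l)" using \<psi>[OF l] .
    finally have "(2 * y * c)\<^sup>2 \<le> (cmod (\<psi> l))\<^sup>2" using y c by (intro power_mono) auto
    then have "4 * (c\<^sup>2 * y\<^sup>2) \<le> (cmod (\<psi> l))\<^sup>2" by (simp add: power_mult_distrib mult_ac)
    then have "4 * (c\<^sup>2 * y\<^sup>2) / (2 * s) \<le> (cmod (\<psi> l))\<^sup>2 / (2 * s)"
      using s by (intro divide_right_mono) auto
    then have "2 * (c\<^sup>2 * y\<^sup>2) / s \<le> (cmod (\<psi> l))\<^sup>2 / (2 * s)" by simp
    then have "exp (- (cmod (\<psi> l))\<^sup>2 / (2 * s)) \<le> exp (- (2 * (c\<^sup>2 * y\<^sup>2) / s))" by simp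
    also have "\<dots> = 1 / exp (2 * (c\<^sup>2 * y\<^sup>2) / s)" by (simp add: exp_minus divide_inverse)
    also have "\<dots> \<le> 1 / (2 * (c\<^sup>2 * y\<^sup>2) / s)"
      using s c y
      by (intro divide_left_mono mult_pos_pos order_trans[OF _ exp_ge_add_one_self]) auto
    finally have "2 * pi / s * exp (- (cmod (\<psi> l))\<^sup>2 / (2 * s)) \<le> 2 * pi / s * (1 / (2 * (c\<^sup>2 * y\<^sup>2) / s))"
      using s by (intro mult_left_mono) auto
    also have "\<dots> = pi / (c\<^sup>2 * y\<^sup>2)" using s c y by (simp add: field_simps)
    finally show ?thesis .
  qed
  have fin: "emeasure lborel (cball a \<eta>) < \<infinity>"
    by (rule emeasure_bounded_finite) auto
  have "(\<integral>l. indicator (cball a \<eta>) l * (2 * pi / s * exp (- (cmod (\<psi> l))\<^sup>2 / (2 * s))) \<partial>lborel)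
      \<le> (\<integral>l. pi / (c\<^sup>2 * y\<^sup>2) * indicator (cball a \<eta>) l \<partial>lborel)"
  proof (rule integral_mono')
    show "integrable lborel (\<lambda>l. pi / (c\<^sup>2 * y\<^sup>2) * indicator (cball a \<eta>) l :: real)"
      using fin by (intro integrable_mult_right integrable_real_indicator) auto
    show "indicator (cball a \<eta>) l * (2 * pi / s * exp (- (cmod (\<psi> l))\<^sup>2 / (2 * s))) \<le> pi / (c\<^sup>2 * y\<^sup>2) * indicator (cball a \<eta>) l" for l
      using pw[of l] by (cases "l \<in> cball a \<eta>") auto
  qed auto
  also have "\<dots> = pi * measure lborel (cball a \<eta>) / (c\<^sup>2 * y\<^sup>2)"
    by simp
  also have "\<dots> \<le> (pi * measure lborel (cball a \<eta>) + 4 * pi\<^sup>2) / (c\<^sup>2 * y\<^sup>2)"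
    using c y by (intro divide_right_mono) auto
  finally show ?thesis .
next
  assume E: "\<forall>l\<in>cball a \<eta>. \<forall>m\<in>cball a \<eta>. c * cmod (l - m) \<le> cmod (\<phi> l - \<phi> m)"
  \<comment> \<open>A minimiser of the modulus replaces a zero, which may not exist in the disc: the
    expansion bound still gives \<open>c * cmod (l - m) \<le> 2 * cmod (\<phi> l)\<close>.\<close>
  obtain m where m: "m \<in> cball a \<eta>" "\<And>l. l \<in> cball a \<eta> \<Longrightarrow> cmod (\<phi> m) \<le> cmod (\<phi> l)"
  proof -
    have "continuous_on (cball a \<eta>) (\<lambda>l. cmod (\<phi> l))" by (intro continuous_intros cont)
    then show ?thesis
      using continuous_attains_inf[of "cball a \<eta>" "\<lambda>l. cmod (\<phi> l)"] \<eta> that by force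
  qed
  define q where "q = c\<^sup>2 * y\<^sup>2 / s"
  have q: "q > 0" using c y s by (simp add: q_def)
  have pw: "exp (- (cmod (\<psi> l))\<^sup>2 / (2 * s)) \<le> exp (- q * (cmod (l - m))\<^sup>2 / 2)" if l: "l \<in> cball a \<eta>" for l
  proof -
    have "c * cmod (l - m) \<le> cmod (\<phi> l) + cmod (\<phi> m)"
      using E l m(1) norm_triangle_ineq4[of "\<phi> l" "\<phi> m"] by (meson order_trans)
    also have "\<dots> \<le> 2 * cmod (\<phi> l)" using m(2)[OF l] by simp
    finally have "y * (c * cmod (l - m)) \<le> y * (2 * cmod (\<phi> l))" using y by (intro mult_left_mono) auto
    also have "\<dots> \<le> cmod (\<psi> l)" using \<psi>[OF l] by (simp add: mult_ac)
    finally have "(y * (c * cmod (l - m)))\<^sup>2 \<le> (cmod (\<psi> l))\<^sup>2" using y c by (intro power_mono) auto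
    then have "(y * (c * cmod (l - m)))\<^sup>2 / (2 * s) \<le> (cmod (\<psi> l))\<^sup>2 / (2 * s)"
      using s by (intro divide_right_mono) auto
    then show ?thesis by (simp add: q_def power_mult_distrib mult_ac)
  qed
  have "(\<integral>l. indicator (cball a \<eta>) l * (2 * pi / s * exp (- (cmod (\<psi> l))\<^sup>2 / (2 * s))) \<partial>lborel)
      \<le> (\<integral>l. 2 * pi / s * exp (- q * (cmod (l - m))\<^sup>2 / 2) \<partial>lborel)"
  proof (rule integral_mono')
    show "integrable lborel (\<lambda>l. 2 * pi / s * exp (- q * (cmod (l - m))\<^sup>2 / 2))"
      by (intro integrable_mult_right gaussian_translate q)
    show "indicator (cball a \<eta>) l * (2 * pi / s * exp (- (cmod (\<psi> l))\<^sup>2 / (2 * s))) \<le> 2 * pi / s * exp (- q * (cmod (l - m))\<^sup>2 / 2)" for l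
    proof (cases "l \<in> cball a \<eta>")
      case True
      then show ?thesis using pw[OF True] s by (simp add: divide_right_mono)
    qed (use s in auto)
  qed (use s in auto)
  also have "\<dots> = 2 * pi / s * (2 * pi / q)"
    by (simp only: integral_mult_right_zero gaussian_translate(2)[OF q])
  also have "\<dots> = 4 * pi\<^sup>2 / (c\<^sup>2 * y\<^sup>2)"
    using s c y by (simp add: q_def field_simps power2_eq_square)
  also have "\<dots> \<le> (pi * measure lborel (cball a \<eta>) + 4 * pi\<^sup>2) / (c\<^sup>2 * y\<^sup>2)"
    using c y by (intro divide_right_mono) auto
  finally show ?thesis .
qed

text \<open>The squared Fourier transform of the law of the finite sum of \<open>N\<close> signed
  powers of \<open>l\<close> with exponents \<open>e\<close>, \<open>e + k\<close>,
  \<open>e + 2 * k\<close> and so on. Its integral in \<xi> is therefore an \<open>L\<^sup>2\<close>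
  energy.\<close>

definition cosprod :: "nat \<Rightarrow> nat \<Rightarrow> nat \<Rightarrow> complex \<Rightarrow> complex \<Rightarrow> real" where
  "cosprod k e N l \<xi> = (\<Prod>i<N. (cos (\<xi> \<bullet> l ^ (e + k * i)))\<^sup>2)"

lemma cosprod_nonneg: "0 \<le> cosprod k e N l \<xi>"
  by (simp add: cosprod_def prod_nonneg)

lemma cosprod_le_1: "cosprod k e N l \<xi> \<le> 1"
  unfolding cosprod_def by (intro prod_le_1) (auto simp: abs_square_le_1)

lemma cosprod_Suc: "cosprod k e (Suc N) l \<xi> = (cos (\<xi> \<bullet> l ^ e))\<^sup>2 * cosprod k (e + k) N l \<xi>"
  unfolding cosprod_def by (subst prod.lessThan_Suc_shift) (simp add: add.assoc)

lemma cosprod_antimono: "cosprod k e (Suc N) l \<xi> \<le> cosprod k e N l \<xi>"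
  unfolding cosprod_def prod.lessThan_Suc
  by (intro mult_left_le prod_nonneg) (auto simp: abs_square_le_1)

lemma measurable_cosprod [measurable]:
  "(\<lambda>p. cosprod k e N (fst p) (snd p)) \<in> borel_measurable (borel \<Otimes>\<^sub>M borel)"
  unfolding cosprod_def by measurable

text \<open>The vanishing coefficient cannot be the constant one, so the constant term stays
  1.\<close>

lemma unit_polys_extend:
  assumes "f \<in> unit_polys" "coeff f m = 0" "c \<in> {-1, 1}"
  shows "f + monom c m \<in> unit_polys"
  using assms by (auto simp: unit_polys_def)

text \<open>Expanding the squared cosines by \<open>cos A * cos\<^sup>2 b = cos A / 2 + cos (A + 2 * b) / 4 + cos (A - 2 * b) / 4\<close>
  only produces polynomials whose further coefficients are \<open>-1\<close>, \<open>0\<close> or \<open>1\<close>.\<close>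

lemma integral_cos_cosprod_le:
  fixes M :: "(complex \<times> complex) measure"
  assumes fin: "finite_measure M" and sets_M: "sets M = sets (borel \<Otimes>\<^sub>M borel)"
    and bound: "\<And>f. f \<in> unit_polys \<Longrightarrow>
      (\<integral>p. cos (2 * (snd p \<bullet> (fst p ^ e * poly f (fst p ^ k)))) \<partial>M) \<le> B"
  shows "f \<in> unit_polys \<Longrightarrow> (\<forall>i\<ge>m. coeff f i = 0) \<Longrightarrow> 
      (\<integral>p. cos (2 * (snd p \<bullet> (fst p ^ e * poly f (fst p ^ k)))) * cosprod k (e + k * m) L (fst p) (snd p) \<partial>M) \<le> B"
proof (induction L arbitrary: m f)
  case 0
  then show ?case using bound by (simp add: cosprod_def)
next
  case (Suc L)
  interpret finite_measure M by fact
  note [measurable_cong] = sets_M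
  define R where "R p = cosprod k (e + k * Suc m) L (fst p) (snd p)" for p
  define X where "X g p = cos (2 * (snd p \<bullet> (fst p ^ e * poly g (fst p ^ k)))) * R p" for g p
  have [measurable]: "R \<in> borel_measurable M" unfolding R_def by measurable
  have [measurable]: "(\<lambda>z. poly g z) \<in> borel_measurable borel" for g :: "complex poly"
    by (intro borel_measurable_continuous_onI continuous_intros)
  have [measurable]: "X g \<in> borel_measurable M" for g unfolding X_def by measurable
  have int: "integrable M (X g)" for g
  proof (rule integrable_const_bound[where B=1])
    show "AE p in M. norm (X g p) \<le> 1"
      using cosprod_nonneg cosprod_le_1 by (auto simp: X_def R_def abs_mult intro!: mult_le_one)
  qed simp
  have m: "coeff f m = 0" using Suc.prems(2) by simp
  have up: "f + monom 1 m \<in> unit_polys" "f + monom (-1) m \<in> unit_polys"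
    using unit_polys_extend[OF Suc.prems(1) m] by auto
  have step: "cos (2 * (snd p \<bullet> (fst p ^ e * poly f (fst p ^ k)))) * cosprod k (e + k * m) (Suc L) (fst p) (snd p)
      = X f p / 2 + X (f + monom 1 m) p / 4 + X (f + monom (-1) m) p / 4" for p
  proof -
    define A where "A = 2 * (snd p \<bullet> (fst p ^ e * poly f (fst p ^ k)))"
    define b where "b = snd p \<bullet> fst p ^ (e + k * m)"
    have eq: "2 * (snd p \<bullet> (fst p ^ e * poly (f + monom 1 m) (fst p ^ k))) = A + 2 * b"
      "2 * (snd p \<bullet> (fst p ^ e * poly (f + monom (-1) m) (fst p ^ k))) = A - 2 * b"
      by (simp_all add: A_def b_def poly_monom ring_distribs inner_add_right inner_diff_right power_add power_mult)
    have "cos A * (cos b)\<^sup>2 = cos A / 2 + cos (A + 2 * b) / 4 + cos (A - 2 * b) / 4"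
      unfolding cos_add cos_diff cos_double_cos by (simp add: field_simps)
    moreover have "cosprod k (e + k * m + k) L (fst p) (snd p) = R p"
      by (simp add: R_def algebra_simps)
    ultimately show ?thesis
      unfolding cosprod_Suc X_def eq A_def[symmetric] b_def[symmetric] mult.assoc[symmetric]
      by (simp add: ring_distribs)
  qed
  have "(\<integral>p. cos (2 * (snd p \<bullet> (fst p ^ e * poly f (fst p ^ k)))) * cosprod k (e + k * m) (Suc L) (fst p) (snd p) \<partial>M)
      = (\<integral>p. X f p \<partial>M) / 2 + (\<integral>p. X (f + monom 1 m) p \<partial>M) / 4 + (\<integral>p. X (f + monom (-1) m) p \<partial>M) / 4"
    unfolding step using int by simp
  \<comment> \<open>The three weights add up to 1, so the bound does not deteriorate as further
    factors are expanded.\<close>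
  also have "\<dots> \<le> B / 2 + B / 4 + B / 4"
    unfolding X_def R_def using Suc.prems(2)
    by (intro add_mono divide_right_mono Suc.IH up Suc.prems(1)) auto
  finally show ?case by simp
qed

text \<open>Writing the first factor as \<open>1/2 + cos (2 * b) / 2\<close> with \<open>b\<close>
  its argument gives two halves. The constant half drops the factor and raises \<open>n\<close> by
  one; the other is an average starting from the polynomial 1, at most \<open>C * r ^ n\<close>.
  Iterating yields a geometric series of ratio \<open>r / 2\<close>, whence \<open>r < 2\<close> and
  the constant \<open>C / (2 - r)\<close>.\<close>

lemma integral_cosprod_le:
  fixes M :: "(complex \<times> complex) measure"
  assumes fin: "finite_measure M" and sets_M: "sets M = sets (borel \<Otimes>\<^sub>M borel)" and r: "0 \<le> r" "r < 2" and C: "0 \<le> C"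
    and bound: "\<And>f n. f \<in> unit_polys \<Longrightarrow>
      (\<integral>p. cos (2 * (snd p \<bullet> (fst p ^ (j + k * n) * poly f (fst p ^ k)))) \<partial>M) \<le> C * r ^ n"
  shows "(\<integral>p. cosprod k (j + k * n) N (fst p) (snd p) \<partial>M) \<le> measure M (space M) / 2 ^ N + C / (2 - r) * r ^ n"
proof (induction N arbitrary: n)
  case 0
  have "0 \<le> C / (2 - r) * r ^ n" using r C by simp
  then show ?case by (simp add: cosprod_def)
next
  case (Suc N)
  interpret finite_measure M by fact
  note [measurable_cong] = sets_M
  define e where "e = j + k * n"
  define R where "R p = cosprod k (e + k) N (fst p) (snd p)" for p
  define X where "X p = cos (2 * (snd p \<bullet> (fst p ^ e * poly 1 (fst p ^ k)))) * R p" for p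
  have [measurable]: "R \<in> borel_measurable M" unfolding R_def by measurable
  have [measurable]: "X \<in> borel_measurable M" unfolding X_def by simp
  have int: "integrable M X" "integrable M R"
    by (rule integrable_const_bound[where B=1],
        use cosprod_nonneg cosprod_le_1 in \<open>auto simp: X_def R_def abs_mult intro!: mult_le_one\<close>)+
  have step: "cosprod k e (Suc N) (fst p) (snd p) = R p / 2 + X p / 2" for p
    unfolding cosprod_Suc X_def R_def by (simp add: cos_double_cos field_simps)
  have 1: "(\<integral>p. R p \<partial>M) \<le> measure M (space M) / 2 ^ N + C / (2 - r) * r ^ Suc n"
    using Suc.IH[of "Suc n"] by (simp add: R_def e_def algebra_simps)
  have one: "1 \<in> unit_polys" by (auto simp: unit_polys_def)
  have 2: "(\<integral>p. X p \<partial>M) \<le> C * r ^ n"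
    using integral_cos_cosprod_le[OF fin sets_M, of e k "C * r ^ n" 1 1 N] bound[of _ n] one
    unfolding X_def R_def e_def by simp
  have "(\<integral>p. cosprod k e (Suc N) (fst p) (snd p) \<partial>M) = (\<integral>p. R p \<partial>M) / 2 + (\<integral>p. X p \<partial>M) / 2"
    unfolding step using int by simp
  also have "\<dots> \<le> (measure M (space M) / 2 ^ N + C / (2 - r) * r ^ Suc n) / 2 + C * r ^ n / 2"
    by (intro add_mono divide_right_mono 1 2) auto
  also have "\<dots> = measure M (space M) / 2 ^ Suc N + C / (2 - r) * r ^ n"
    using r by (simp add: field_simps)
  finally show ?case unfolding e_def .
qed

section \<open>Infinite cosine products and their integrability\<close>

definition cosprod_lim :: "nat \<Rightarrow> nat \<Rightarrow> complex \<Rightarrow> complex \<Rightarrow> real" where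
  "cosprod_lim k e l \<xi> = lim (\<lambda>N. cosprod k e N l \<xi>)"

lemma cosprod_LIMSEQ: "(\<lambda>N. cosprod k e N l \<xi>) \<longlonglongrightarrow> cosprod_lim k e l \<xi>"
proof -
  have "decseq (\<lambda>N. cosprod k e N l \<xi>)"
    by (intro decseq_SucI cosprod_antimono)
  then have "convergent (\<lambda>N. cosprod k e N l \<xi>)"
    using decseq_convergent[of _ 0] cosprod_nonneg by (metis convergent_def)
  then show ?thesis unfolding cosprod_lim_def by (simp add: convergent_LIMSEQ_iff)
qed

lemma measurable_cosprod_lim [measurable]:
  "(\<lambda>p. cosprod_lim k e (fst p) (snd p)) \<in> borel_measurable (borel \<Otimes>\<^sub>M borel)"
  by (rule borel_measurable_LIMSEQ_real[OF cosprod_LIMSEQ]) simp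

lemma cosprod_lim_nonneg: "0 \<le> cosprod_lim k e l \<xi>"
  by (rule LIMSEQ_le_const[OF cosprod_LIMSEQ]) (auto simp: cosprod_nonneg)

text \<open>The energy is integrated over a disc of parameters, with a Gaussian cutoff in \<xi> that
  makes the reference measure finite. Removing the cutoff by Fatou bounds the double integral, so
  the inner integral is finite almost everywhere.\<close>

lemma local_energy_finite:
  fixes a :: complex
  assumes k: "k \<ge> 1" and j: "j \<le> k" and Im: "Im (a ^ k) \<noteq> 0" and up: "cmod (a ^ k) < 2 * 5 powr (-5/8)"
    and lo: "1 / 2 < (cmod (a ^ k))\<^sup>2"
  obtains \<eta> where "\<eta> > 0"
    "AE l in lborel. l \<in> ball a \<eta> \<longrightarrow> (\<integral>\<^sup>+\<xi>. ennreal (cosprod_lim k j l \<xi>) \<partial>lborel) < \<infinity>"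
proof -
  obtain \<eta> c \<rho> where \<eta>: "\<eta> > 0" and c: "c > 0" and \<rho>: "\<rho> > 0" "1 / 2 < \<rho>\<^sup>2"
    and lower: "\<And>l. l \<in> cball a \<eta> \<Longrightarrow> \<rho> \<le> cmod l ^ k"
    and less1: "\<And>l. l \<in> cball a \<eta> \<Longrightarrow> cmod l < 1"
    and trans: "\<And>f. f \<in> unit_polys \<Longrightarrow> (\<forall>l\<in>cball a \<eta>. c \<le> cmod (poly f (l ^ k)))
        \<or> (\<forall>l\<in>cball a \<eta>. \<forall>m\<in>cball a \<eta>. c * cmod (l - m) \<le> cmod (poly f (l ^ k) - poly f (m ^ k)))"
    using local_transversality[OF k Im up lo] by blast
  define K where "K = cball a \<eta>"
  have [measurable]: "K \<in> sets borel" by (simp add: K_def)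
  define m where "m = measure lborel K"
  have finK: "emeasure lborel K < \<infinity>" unfolding K_def by (rule emeasure_bounded_finite) simp
  have m: "emeasure lborel K = ennreal m" "m \<ge> 0"
    using finK by (auto simp: m_def emeasure_eq_ennreal_measure)
  define w where "w s p = indicator K (fst p) * exp (- s * (norm (snd p :: complex))\<^sup>2 / 2)" for s :: real and p :: "complex \<times> complex"
  have [measurable]: "w s \<in> borel_measurable (borel \<Otimes>\<^sub>M borel)" for s unfolding w_def by measurable
  have w0: "w s p \<ge> 0" for s p by (simp add: w_def)
  define M where "M s = density (lborel \<Otimes>\<^sub>M lborel) (\<lambda>p. ennreal (w s p))" for s
  have sets_M: "sets (M s) = sets (borel \<Otimes>\<^sub>M borel)" for s
    by (simp add: M_def cong: sets_pair_measure_cong)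
  have gauss: "(\<integral>\<^sup>+\<xi>. ennreal (exp (- s * (norm (\<xi>::complex))\<^sup>2 / 2)) \<partial>lborel) = ennreal (2 * pi / s)" if s: "s > 0" for s
    using nn_integral_eq_integral[OF gaussian_integrable(1)[OF s, where 'a=complex]]
      gaussian_integrable(2)[OF s, where 'a=complex] s by simp
  have emM: "emeasure (M s) (space (M s)) = ennreal (m * (2 * pi / s))" if s: "s > 0" for s
  proof -
    have "emeasure (M s) (space (M s)) = (\<integral>\<^sup>+p. ennreal (w s p) \<partial>(lborel \<Otimes>\<^sub>M lborel))"
      unfolding M_def space_density by (subst emeasure_density[OF _ sets.top]) (auto intro!: nn_integral_cong)
    also have "\<dots> = (\<integral>\<^sup>+l. (\<integral>\<^sup>+\<xi>. ennreal (w s (l, \<xi>)) \<partial>lborel) \<partial>lborel)"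
      by (subst lborel.nn_integral_fst[symmetric]) auto
    also have "\<dots> = (\<integral>\<^sup>+l. indicator K l * ennreal (2 * pi / s) \<partial>lborel)"
      unfolding gauss[OF s, symmetric] w_def
      by (intro nn_integral_cong) (auto simp: indicator_def)
    also have "\<dots> = ennreal m * ennreal (2 * pi / s)"
      by (subst nn_integral_multc) (auto simp: m)
    also have "\<dots> = ennreal (m * (2 * pi / s))"
      using s m(2) by (intro ennreal_mult[symmetric]) auto
    finally show ?thesis .
  qed
  have finM: "finite_measure (M s)" if s: "s > 0" for s
    by (rule finite_measureI) (simp add: emM[OF s])
  have measM: "measure (M s) (space (M s)) = m * (2 * pi / s)" if s: "s > 0" for s
    unfolding measure_def emM[OF s] using s m(2) by simp
  define C where "C = (pi * m + 4 * pi\<^sup>2) / (c\<^sup>2 * \<rho>\<^sup>2)"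
  define r where "r = 1 / \<rho>\<^sup>2"
  have C: "C \<ge> 0" using m(2) by (simp add: C_def)
  have r: "0 \<le> r" "r < 2" using \<rho> by (auto simp: r_def field_simps)
  \<comment> \<open>Integrating over \<xi> first turns the cosine into a Gaussian in
    \<open>\<psi> l\<close>, whose average over the disc is controlled by transversality.\<close>
  have bound: "(\<integral>p. cos (2 * (snd p \<bullet> (fst p ^ (j + k * n) * poly f (fst p ^ k)))) \<partial>M s) \<le> C * r ^ n"
    if f: "f \<in> unit_polys" and s: "s > 0" for f n s
  proof -
    interpret finite_measure "M s" by (rule finM[OF s])
    define \<psi> where "\<psi> l = 2 * (l ^ (j + k * n) * poly f (l ^ k))" for l
    have [measurable]: "\<psi> \<in> borel_measurable borel" unfolding \<psi>_def
      by (intro borel_measurable_continuous_onI continuous_intros)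
    have int: "integrable (M s) (\<lambda>p. cos (snd p \<bullet> \<psi> (fst p)))"
      by (rule integrable_const_bound[where B=1]) (auto simp: M_def)
    have int': "integrable (lborel \<Otimes>\<^sub>M lborel) (\<lambda>p. w s p * cos (snd p \<bullet> \<psi> (fst p)))"
      using int unfolding M_def by (subst (asm) integrable_real_density) (auto simp: w0)
    have two: "x \<bullet> (2 * z) = 2 * (x \<bullet> z)" for x z :: complex
      by (simp add: inner_complex_def algebra_simps)
    have "(\<integral>p. cos (2 * (snd p \<bullet> (fst p ^ (j + k * n) * poly f (fst p ^ k)))) \<partial>M s) = (\<integral>p. cos (snd p \<bullet> \<psi> (fst p)) \<partial>M s)"
      by (intro Bochner_Integration.integral_cong refl) (simp add: \<psi>_def two)
    also have "\<dots> = (\<integral>p. w s p * cos (snd p \<bullet> \<psi> (fst p)) \<partial>(lborel \<Otimes>\<^sub>M lborel))"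
      unfolding M_def by (subst integral_real_density) (auto simp: w0)
    also have "\<dots> = (\<integral>l. (\<integral>\<xi>. w s (l, \<xi>) * cos (\<xi> \<bullet> \<psi> l) \<partial>lborel) \<partial>lborel)"
      using lborel_pair.integral_fst'[OF int'] by simp
    also have "\<dots> = (\<integral>l. indicator K l * (2 * pi / s * exp (- (cmod (\<psi> l))\<^sup>2 / (2 * s))) \<partial>lborel)"
    proof (intro Bochner_Integration.integral_cong refl)
      fix l
      have "(\<integral>\<xi>. cos (\<xi> \<bullet> \<psi> l) * exp (- s * (norm \<xi>)\<^sup>2 / 2) \<partial>lborel) = 2 * pi / s * exp (- (cmod (\<psi> l))\<^sup>2 / (2 * s))"
        using gaussian_fourier[OF s, of "\<psi> l"] s by (simp add: has_bochner_integral_iff)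
      moreover have "(\<integral>\<xi>. w s (l, \<xi>) * cos (\<xi> \<bullet> \<psi> l) \<partial>lborel)
          = (\<integral>\<xi>. indicator K l * (cos (\<xi> \<bullet> \<psi> l) * exp (- s * (norm \<xi>)\<^sup>2 / 2)) \<partial>lborel)"
        by (simp add: w_def mult_ac)
      ultimately show "(\<integral>\<xi>. w s (l, \<xi>) * cos (\<xi> \<bullet> \<psi> l) \<partial>lborel)
          = indicator K l * (2 * pi / s * exp (- (cmod (\<psi> l))\<^sup>2 / (2 * s)))"
        by (simp only: integral_mult_right_zero)
    qed
    also have "\<dots> \<le> (pi * m + 4 * pi\<^sup>2) / (c\<^sup>2 * (\<rho> ^ Suc n)\<^sup>2)"
      unfolding K_def m_def
    proof (rule gaussian_set_integral_bound[OF _ c _ s \<eta> trans[OF f]])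
      fix l assume l: "l \<in> cball a \<eta>"
      \<comment> \<open>Since \<open>j \<le> k\<close> and \<open>cmod l < 1\<close>, the offset
        \<open>j\<close> costs at most one extra factor \<rho>, hence the exponent
        \<open>Suc n\<close>.\<close>
      have "\<rho> \<le> cmod l ^ j"
        using lower[OF l] power_decreasing[OF j, of "cmod l"] less1[OF l] by simp
      moreover have "\<rho> ^ n \<le> cmod l ^ (k * n)"
        unfolding power_mult using lower[OF l] \<rho>(1) by (intro power_mono) auto
      ultimately have "\<rho> * \<rho> ^ n \<le> cmod l ^ j * cmod l ^ (k * n)"
        using \<rho>(1) by (intro mult_mono) auto
      then have "\<rho> ^ Suc n * cmod (poly f (l ^ k)) \<le> cmod l ^ (j + k * n) * cmod (poly f (l ^ k))"
        by (intro mult_right_mono) (auto simp: power_add)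
      then show "2 * \<rho> ^ Suc n * cmod (poly f (l ^ k)) \<le> cmod (\<psi> l)"
        by (simp add: \<psi>_def norm_mult norm_power)
    qed (use \<rho>(1) in \<open>auto intro!: continuous_intros\<close>)
    also have "\<dots> = C * r ^ n"
      using \<rho>(1) c by (simp add: C_def r_def power_mult_distrib power_divide field_simps flip: power_mult)
    finally show ?thesis .
  qed
  define B where "B = m * (2 * pi) + C / (2 - r)"
  \<comment> \<open>The mass of \<open>M (s N)\<close> grows like \<open>2 ^ N\<close>, exactly
    compensated by the division by \<open>2 ^ N\<close> in the bound for \<open>N\<close> cosine
    factors. One index thus removes the cutoff and completes the product at the same time.\<close>
  define s where "s N = (1::real) / 2 ^ N" for N :: nat
  have s: "s N > 0" for N by (simp add: s_def)
  have s0: "s \<longlonglongrightarrow> 0"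
    using LIMSEQ_power_zero[of "1/2 :: real"] by (simp add: s_def[abs_def] power_one_over)
  have Bbound: "(\<integral>\<^sup>+p. ennreal (w (s N) p * cosprod k j N (fst p) (snd p)) \<partial>(lborel \<Otimes>\<^sub>M lborel)) \<le> ennreal B" for N
  proof -
    interpret finite_measure "M (s N)" by (rule finM[OF s])
    have int: "integrable (M (s N)) (\<lambda>p. cosprod k j N (fst p) (snd p))"
      by (rule integrable_const_bound[where B=1]) (auto simp: cosprod_nonneg cosprod_le_1 M_def)
    have "(\<integral>\<^sup>+p. ennreal (w (s N) p * cosprod k j N (fst p) (snd p)) \<partial>(lborel \<Otimes>\<^sub>M lborel))
        = (\<integral>\<^sup>+p. ennreal (cosprod k j N (fst p) (snd p)) \<partial>M (s N))"
      unfolding M_def by (subst nn_integral_density) (auto simp: w0 cosprod_nonneg ennreal_mult)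
    also have "\<dots> = ennreal (\<integral>p. cosprod k j N (fst p) (snd p) \<partial>M (s N))"
      by (rule nn_integral_eq_integral[OF int]) (simp add: cosprod_nonneg)
    also have "\<dots> \<le> ennreal B"
      using integral_cosprod_le[OF finM[OF s] sets_M r C bound[OF _ s], of N 0 N]
      unfolding measM[OF s] by (intro ennreal_leI) (simp add: B_def s_def)
    finally show ?thesis .
  qed
  define T where "T p = indicator K (fst p) * ennreal (cosprod_lim k j (fst p) (snd p))" for p
  have [measurable]: "T \<in> borel_measurable (borel \<Otimes>\<^sub>M borel)" unfolding T_def by measurable
  have "T p = liminf (\<lambda>N. ennreal (w (s N) p * cosprod k j N (fst p) (snd p)))" for p
  proof -
    have "(\<lambda>N. ennreal (w (s N) p * cosprod k j N (fst p) (snd p)))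
        \<longlonglongrightarrow> ennreal (indicator K (fst p) * exp (- 0 * (norm (snd p))\<^sup>2 / 2) * cosprod_lim k j (fst p) (snd p))"
      unfolding w_def by (intro tendsto_intros tendsto_ennrealI s0 cosprod_LIMSEQ) auto
    then have "(\<lambda>N. ennreal (w (s N) p * cosprod k j N (fst p) (snd p))) \<longlonglongrightarrow> T p"
      by (cases "fst p \<in> K") (simp_all add: T_def)
    then show ?thesis by (intro lim_imp_Liminf[symmetric]) auto
  qed
  then have "(\<integral>\<^sup>+p. T p \<partial>(lborel \<Otimes>\<^sub>M lborel)) = (\<integral>\<^sup>+p. liminf (\<lambda>N. ennreal (w (s N) p * cosprod k j N (fst p) (snd p))) \<partial>(lborel \<Otimes>\<^sub>M lborel))"
    by simp
  also have "\<dots> \<le> liminf (\<lambda>N. \<integral>\<^sup>+p. ennreal (w (s N) p * cosprod k j N (fst p) (snd p)) \<partial>(lborel \<Otimes>\<^sub>M lborel))"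
    by (rule nn_integral_liminf) measurable
  also have "\<dots> \<le> liminf (\<lambda>N. ennreal B)"
    by (intro Liminf_mono always_eventually allI Bbound)
  also have "\<dots> < \<infinity>" by (simp add: Liminf_const)
  also have "(\<integral>\<^sup>+p. T p \<partial>(lborel \<Otimes>\<^sub>M lborel)) = (\<integral>\<^sup>+l. (\<integral>\<^sup>+\<xi>. T (l, \<xi>) \<partial>lborel) \<partial>lborel)"
    by (subst lborel.nn_integral_fst[symmetric]) auto
  finally have "AE l in lborel. (\<integral>\<^sup>+\<xi>. T (l, \<xi>) \<partial>lborel) \<noteq> \<infinity>"
    by (intro nn_integral_PInf_AE) auto
  then have "AE l in lborel. l \<in> ball a \<eta> \<longrightarrow> (\<integral>\<^sup>+\<xi>. ennreal (cosprod_lim k j l \<xi>) \<partial>lborel) < \<infinity>"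
  proof eventually_elim
    case (elim l)
    then show ?case by (auto simp: T_def K_def less_top)
  qed
  then show thesis using \<eta> that by blast
qed

text \<open>As \<open>k \<ge> 2\<close>, the residue classes 0 and 1 are disjoint, so the Fourier
  transform is bounded by the product of two subproducts. Estimating \<open>x * y\<close> by
  \<open>x\<^sup>2 + y\<^sup>2\<close> gives the sum of the two energy densities as integrable
  majorant for Fourier inversion.\<close>

lemma good_param_if_energy_finite:
  assumes l: "cmod l < 1" and k: "k \<ge> 2"
    and fin: "(\<integral>\<^sup>+\<xi>. ennreal (cosprod_lim k 0 l \<xi>) \<partial>lborel) < \<infinity>"
      "(\<integral>\<^sup>+\<xi>. ennreal (cosprod_lim k 1 l \<xi>) \<partial>lborel) < \<infinity>"
  shows "good_param l"
proof (rule good_param_if_continuous_density[OF l], rule fourier_inversion_density[OF prob_space_nu sets_nu])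
  have [measurable]: "cosprod_lim k j l \<in> borel_measurable borel" for j
    using measurable_compose[OF measurable_Pair1'[of l borel borel] measurable_cosprod_lim[of k j]] by simp
  show "integrable lborel (\<lambda>\<xi>. cosprod_lim k 0 l \<xi> + cosprod_lim k 1 l \<xi>)"
    using fin by (intro Bochner_Integration.integrable_add integrableI_bounded) (auto simp: cosprod_lim_nonneg)
  fix \<xi> z
  show "\<bar>\<integral>x. cos (\<xi> \<bullet> (z - x)) \<partial>nu l\<bar> \<le> cosprod_lim k 0 l \<xi> + cosprod_lim k 1 l \<xi>"
  proof (rule LIMSEQ_le_const[OF tendsto_add[OF cosprod_LIMSEQ cosprod_LIMSEQ]], intro exI[of _ 0] allI impI)
    fix N
    define u where "u n = \<bar>cos (\<xi> \<bullet> l ^ n)\<bar>" for n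
    have u: "0 \<le> u n" "u n \<le> 1" for n by (auto simp: u_def)
    define I where "I j = (\<lambda>i. j + k * i) ` {..<N}" for j
    have sub: "I 0 \<union> I 1 \<subseteq> {..<k * N}"
    proof -
      have "j + k * i < k * N" if "i < N" "j \<le> 1" for i j
      proof -
        have "j + k * i < k * Suc i" using that(2) k by simp
        also have "\<dots> \<le> k * N" using that(1) by (intro mult_le_mono2) simp
        finally show ?thesis .
      qed
      from this[of _ 0] this[of _ 1] k show ?thesis by (auto simp: I_def)
    qed
    have disj: "I 0 \<inter> I 1 = {}"
    proof -
      have "k * i \<noteq> 1 + k * i'" for i i'
      proof
        assume "k * i = 1 + k * i'"
        then have "k dvd 1" by (metis dvd_add_left_iff dvd_triv_left)
        then show False using k by simp
      qed
      then show ?thesis by (auto simp: I_def)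
    qed
    have inj: "inj_on (\<lambda>i. j + k * i) {..<N}" for j using k by (auto intro!: inj_onI)
    have I: "(\<Prod>n\<in>I j. u n) = (\<Prod>i<N. u (j + k * i))" for j
      unfolding I_def using inj by (subst prod.reindex) auto
    have "\<bar>\<integral>x. cos (\<xi> \<bullet> (z - x)) \<partial>nu l\<bar> \<le> (\<Prod>n<k * N. u n)"
      unfolding u_def by (rule nu_cos_bound[OF l])
    also have "\<dots> = (\<Prod>n\<in>{..<k * N} - (I 0 \<union> I 1). u n) * (\<Prod>n\<in>I 0 \<union> I 1. u n)"
      by (rule prod.subset_diff[OF sub]) simp
    also have "\<dots> \<le> 1 * (\<Prod>n\<in>I 0 \<union> I 1. u n)"
      by (intro mult_right_mono prod_le_1 prod_nonneg) (auto simp: u)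
    also have "\<dots> = (\<Prod>i<N. u (0 + k * i)) * (\<Prod>i<N. u (1 + k * i))"
      unfolding I[symmetric] mult_1_left by (rule prod.union_disjoint) (use disj in \<open>auto simp: I_def\<close>)
    also have "\<dots> \<le> (\<Prod>i<N. u (0 + k * i))\<^sup>2 + (\<Prod>i<N. u (1 + k * i))\<^sup>2"
    proof -
      have "x * y \<le> x\<^sup>2 + y\<^sup>2" for x y :: real
        using sum_squares_bound[of x y] zero_le_power2[of x] zero_le_power2[of y] by linarith
      then show ?thesis .
    qed
    also have "\<dots> = cosprod k 0 N l \<xi> + cosprod k 1 N l \<xi>"
      by (simp add: cosprod_def u_def prod_power_distrib)
    finally show "\<bar>\<integral>x. cos (\<xi> \<bullet> (z - x)) \<partial>nu l\<bar> \<le> cosprod k 0 N l \<xi> + cosprod k 1 N l \<xi>" .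
  qed
qed

section \<open>Almost every parameter\<close>

text \<open>For nonzero \<open>l\<close>, a real power \<open>l ^ k\<close> forces
  \<open>l / cmod l\<close> to be a root of unity of order dividing \<open>2 * k\<close>. So the
  exceptional set lies in finitely many lines through 0, each written as the hyperplane orthogonal
  to \<open>\<i> * \<omega>\<close>.\<close>

lemma AE_power_not_real:
  assumes "k \<ge> 1"
  shows "AE l in lborel. Im (l ^ k) \<noteq> 0"
proof -
  define Z where "Z = {\<omega>::complex. \<omega> ^ (2 * k) = 1}"
  have "finite Z" unfolding Z_def using assms by (intro finite_roots_unity) auto
  have neg: "negligible {x. (\<i> * \<omega>) \<bullet> x = 0}" if "\<omega> \<in> Z" for \<omega>
  proof (rule negligible_hyperplane)
    show "\<i> * \<omega> \<noteq> 0 \<or> (0::real) \<noteq> 0" using that assms by (auto simp: Z_def power_0_left)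
  qed
  have "{l. Im (l ^ k) = 0} \<subseteq> (\<Union>\<omega>\<in>Z. {x. (\<i> * \<omega>) \<bullet> x = 0})"
  proof
    fix l assume "l \<in> {l. Im (l ^ k) = 0}"
    then have re: "l ^ k = of_real (Re (l ^ k))" by (simp add: complex_eq_iff)
    show "l \<in> (\<Union>\<omega>\<in>Z. {x. (\<i> * \<omega>) \<bullet> x = 0})"
    proof (cases "l = 0")
      case True
      have "1 \<in> Z" by (simp add: Z_def)
      then show ?thesis using True by force
    next
      case False
      define \<omega> where "\<omega> = l / of_real (cmod l)"
      have "(l ^ k)\<^sup>2 = of_real ((Re (l ^ k))\<^sup>2)" by (subst re) simp
      also have "(Re (l ^ k))\<^sup>2 = (cmod (l ^ k))\<^sup>2"
        by (subst (2) re) (simp only: norm_of_real power2_abs)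
      finally have "l ^ (2 * k) = of_real (cmod l ^ (2 * k))"
        by (simp add: norm_power power_mult mult.commute[of 2])
      then have "\<omega> ^ (2 * k) = 1" using False by (simp add: \<omega>_def power_divide)
      then have "\<omega> \<in> Z" by (simp add: Z_def)
      moreover have "(\<i> * \<omega>) \<bullet> l = 0" by (simp add: \<omega>_def inner_complex_def Re_divide Im_divide)
      ultimately show ?thesis by blast
    qed
  qed
  moreover have "negligible (\<Union>\<omega>\<in>Z. {x. (\<i> * \<omega>) \<bullet> x = 0})"
    using \<open>finite Z\<close> neg by (intro negligible_Union) auto
  ultimately have "negligible {l. Im (l ^ k) = 0}" by (rule negligible_subset[rotated])
  then have "{l. Im (l ^ k) = 0} \<in> null_sets lebesgue"
    by (simp add: negligible_iff_null_sets)
  then have "AE l in lebesgue. l \<notin> {l. Im (l ^ k) = 0}" by (rule AE_not_in)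
  then show ?thesis by (simp add: AE_completion_iff)
qed

lemma AE_good_param_power:
  assumes k: "k \<ge> 2"
  shows "AE l in lborel. cmod (l ^ k) < 2 * 5 powr (-5/8) \<and> 1 / 2 < (cmod (l ^ k))\<^sup>2 \<and> cmod l < 1 \<longrightarrow> good_param l"
proof -
  define S where "S = {l. Im (l ^ k) \<noteq> 0 \<and> cmod (l ^ k) < 2 * 5 powr (-5/8) \<and> 1 / 2 < (cmod (l ^ k))\<^sup>2 \<and> cmod l < 1}"
  have "\<exists>\<eta>>0. AE l in lborel. l \<in> ball a \<eta> \<longrightarrow> cmod l < 1 \<longrightarrow> good_param l" if "a \<in> S" for a
  proof -
    have a: "1 \<le> k" "0 \<le> k" "Im (a ^ k) \<noteq> 0" "cmod (a ^ k) < 2 * 5 powr (-5/8)" "1 / 2 < (cmod (a ^ k))\<^sup>2"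
      using that k by (auto simp: S_def)
    obtain \<eta>0 where \<eta>0: "\<eta>0 > 0"
      "AE l in lborel. l \<in> ball a \<eta>0 \<longrightarrow> (\<integral>\<^sup>+\<xi>. ennreal (cosprod_lim k 0 l \<xi>) \<partial>lborel) < \<infinity>"
      using local_energy_finite[OF a] by blast
    obtain \<eta>1 where \<eta>1: "\<eta>1 > 0"
      "AE l in lborel. l \<in> ball a \<eta>1 \<longrightarrow> (\<integral>\<^sup>+\<xi>. ennreal (cosprod_lim k 1 l \<xi>) \<partial>lborel) < \<infinity>"
      using local_energy_finite[OF a(1,1,3-)] by blast
    have "AE l in lborel. l \<in> ball a (min \<eta>0 \<eta>1) \<longrightarrow> cmod l < 1 \<longrightarrow> good_param l"
      using \<eta>0(2) \<eta>1(2)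
      by eventually_elim (use good_param_if_energy_finite[OF _ k] in auto)
    then show ?thesis using \<eta>0(1) \<eta>1(1) by (intro exI[of _ "min \<eta>0 \<eta>1"]) auto
  qed
  then obtain \<eta> where \<eta>: "\<And>a. a \<in> S \<Longrightarrow> \<eta> a > 0"
    "\<And>a. a \<in> S \<Longrightarrow> AE l in lborel. l \<in> ball a (\<eta> a) \<longrightarrow> cmod l < 1 \<longrightarrow> good_param l"
    by metis
  \<comment> \<open>Lindelof: the exceptional null sets come from uncountably many discs, but
    countably many discs cover the same set.\<close>
  obtain F where F: "F \<subseteq> (\<lambda>a. ball a (\<eta> a)) ` S" "countable F" "\<Union>F = (\<Union>a\<in>S. ball a (\<eta> a))"
    using Lindelof[of "(\<lambda>a. ball a (\<eta> a)) ` S"] by auto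
  have "AE l in lborel. \<forall>U\<in>F. l \<in> U \<longrightarrow> cmod l < 1 \<longrightarrow> good_param l"
    using F(1) \<eta>(2) by (subst AE_ball_countable[OF F(2)]) blast
  moreover have "AE l in lborel. Im (l ^ k) \<noteq> 0" using k by (intro AE_power_not_real) simp
  ultimately show ?thesis
  proof eventually_elim
    case (elim l)
    show ?case
    proof
      assume "cmod (l ^ k) < 2 * 5 powr (-5/8) \<and> 1 / 2 < (cmod (l ^ k))\<^sup>2 \<and> cmod l < 1"
      with elim(2) have "l \<in> S" "cmod l < 1" by (auto simp: S_def)
      then have "l \<in> \<Union>F" unfolding F(3) using \<eta>(1) by force
      then show "good_param l" using elim(1) \<open>cmod l < 1\<close> by blast
    qed
  qed
qed

section \<open>The annuli of moduli and their overlap\<close>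

lemma power_annulus:
  assumes k: "k \<ge> 1" and lo: "2 powr (-1 / (2 * real k)) < x" and up: "x < (2 * 5 powr (-5/8)) powr (1 / real k)"
  shows "x ^ k < 2 * 5 powr (-5/8)" "1 / 2 < (x ^ k)\<^sup>2"
proof -
  have x: "x > 0" using lo powr_ge_zero[of 2 "-1 / (2 * real k)"] by linarith
  have "x ^ k < ((2 * 5 powr (-5/8)) powr (1 / real k)) ^ k"
    using up x k by (intro power_strict_mono) auto
  also have "\<dots> = 2 * 5 powr (-5/8)" using k by (simp add: powr_power)
  finally show "x ^ k < 2 * 5 powr (-5/8)" .
  have "(2 powr (-1 / (2 * real k))) ^ (2 * k) < x ^ (2 * k)"
    using lo k by (intro power_strict_mono) auto
  also have "(2 powr (-1 / (2 * real k))) ^ (2 * k) = 2 powr (- 1)" using k by (simp add: powr_power)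
  finally show "1 / 2 < (x ^ k)\<^sup>2" by (simp add: powr_minus power_mult mult.commute[of 2])
qed

text \<open>The lower end of the annulus for \<open>k = 10\<close> is \<open>2 powr (-1/20)\<close>,
  and from there on consecutive annuli overlap. In terms of \<open>L = - ln x\<close>, the two
  conditions read \<open>real k < q\<close> and
  \<open>5/8 * ln 5 - ln 2 < real k * L\<close>.\<close>

lemma annuli_cover:
  fixes x :: real
  assumes lo: "2 powr (-1/20) < x" and up: "x < 1"
  obtains k where "k \<ge> (2::nat)" "2 powr (-1 / (2 * real k)) < x" "x < (2 * 5 powr (-5/8)) powr (1 / real k)"
proof -
  have x: "x > 0" using lo powr_ge_zero[of 2 "-1/20"] by linarith
  define L where "L = - ln x"
  have L: "L > 0" using x up by (simp add: L_def)
  have "ln (2 powr (-1/20)) < ln x" using lo x by (subst ln_less_cancel_iff) auto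
  then have L20: "L < ln 2 / 20" by (simp add: L_def ln_powr)
  define q where "q = ln 2 / (2 * L)"
  have q: "q > 10" using L L20 by (simp add: q_def field_simps)
  \<comment> \<open>The largest integer strictly below \<open>q\<close>; the ceiling minus one,
    unlike the floor, keeps \<open>real k < q\<close> strict when \<open>q\<close> is an
    integer.\<close>
  define k where "k = nat (\<lceil>q\<rceil> - 1)"
  have ceil: "of_int \<lceil>q\<rceil> - 1 < q" "q \<le> of_int \<lceil>q\<rceil>" using ceiling_correct[of q] by auto
  have "\<lceil>q\<rceil> > 10" using q by (simp add: less_ceiling_iff)
  then have kr: "real k = of_int \<lceil>q\<rceil> - 1" and k10: "k \<ge> 10" unfolding k_def by arith+
  have k1: "real k < q" "q \<le> real k + 1" using ceil kr by auto
  have kp: "real k > 0" using k10 by simp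
  have A: "L < ln 2 / (2 * real k)" using k1(1) L kp by (simp add: q_def field_simps)
  have B: "ln 2 / (2 * (real k + 1)) \<le> L" using k1(2) L kp by (simp add: q_def field_simps)
  \<comment> \<open>The integer form of \<open>5/8 * ln 5 - ln 2 < 5/11 * ln 2\<close>, where
    \<open>5/11\<close> is \<open>k / (2 * (k + 1))\<close> at the worst case
    \<open>k = 10\<close>.\<close>
  have "(5::real) ^ 55 < 2 ^ 128" by simp
  then have "ln ((5::real) ^ 55) < ln (2 ^ 128)" by (subst ln_less_cancel_iff) auto
  then have "real 55 * ln 5 < real 128 * ln 2"
    unfolding ln_realpow .
  then have "5/8 * ln 5 - ln 2 < 5/11 * ln (2::real)" by simp
  also have "5/11 * ln 2 \<le> real k * (ln 2 / (2 * (real k + 1)))"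
  proof -
    have "5/11 * (2 * (real k + 1)) \<le> real k" using k10 by simp
    then have "5/11 \<le> real k / (2 * (real k + 1))" using kp by (simp add: le_divide_eq)
    then have "5/11 * ln 2 \<le> real k / (2 * (real k + 1)) * ln (2::real)" by (intro mult_right_mono) auto
    then show ?thesis by simp
  qed
  also have "\<dots> \<le> real k * L" using B kp by (intro mult_left_mono) auto
  finally have C: "5/8 * ln 5 - ln 2 < real k * L" .
  have "ln (2 powr (-1 / (2 * real k))) < ln x"
    using A by (simp add: L_def ln_powr)
  then have 1: "2 powr (-1 / (2 * real k)) < x" using x by (subst (asm) ln_less_cancel_iff) auto
  have "ln x < ln ((2 * 5 powr (-5/8)) powr (1 / real k))"
    using C kp by (simp add: L_def ln_powr ln_mult field_simps)
  then have 2: "x < (2 * 5 powr (-5/8)) powr (1 / real k)" using x by (subst (asm) ln_less_cancel_iff) auto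
  show thesis using that[of k] 1 2 k10 by simp
qed

theorem mainTheorem17:
  shows "(AE l in lborel.
            (\<exists>k::nat. k \<ge> 2 \<and> 2 powr (-1 / (2 * real k)) < cmod l
                 \<and> cmod l < (2 * 5 powr (-5/8)) powr (1 / real k))
            \<longrightarrow> good_param l)
       \<and> (AE l in lborel. (cmod l < 1 \<and> 2 powr (-1/20) < cmod l) \<longrightarrow> good_param l)"
proof -
  have "AE l in lborel. \<forall>k\<in>{2..}. cmod (l ^ k) < 2 * 5 powr (-5/8) \<and> 1 / 2 < (cmod (l ^ k))\<^sup>2 \<and> cmod l < 1 \<longrightarrow> good_param l"
    by (subst AE_ball_countable, simp) (intro ballI AE_good_param_power, simp)
  then have main: "AE l in lborel. (\<exists>k::nat. k \<ge> 2 \<and> 2 powr (-1 / (2 * real k)) < cmod l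
                 \<and> cmod l < (2 * 5 powr (-5/8)) powr (1 / real k)) \<longrightarrow> good_param l"
  proof eventually_elim
    case (elim l)
    show ?case
    proof
      assume "\<exists>k::nat. k \<ge> 2 \<and> 2 powr (-1 / (2 * real k)) < cmod l
                 \<and> cmod l < (2 * 5 powr (-5/8)) powr (1 / real k)"
      then obtain k :: nat where k: "k \<ge> 2" "2 powr (-1 / (2 * real k)) < cmod l"
        "cmod l < (2 * 5 powr (-5/8)) powr (1 / real k)" by blast
      have ann: "cmod (l ^ k) < 2 * 5 powr (-5/8)" "1 / 2 < (cmod (l ^ k))\<^sup>2"
        using power_annulus[OF _ k(2,3)] k(1) by (auto simp: norm_power)
      have "cmod l ^ k < 1" using ann(1) transversality_radius_lt_1 by (simp add: norm_power)
      then have "cmod l < 1" by (metis linorder_not_less one_le_power)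
      then show "good_param l" using elim k(1) ann by auto
    qed
  qed
  moreover have "AE l in lborel. (cmod l < 1 \<and> 2 powr (-1/20) < cmod l) \<longrightarrow> good_param l"
    using main
  proof eventually_elim
    case (elim l)
    then show ?case by (metis annuli_cover)
  qed
  ultimately show ?thesis by blast
qed

end
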